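(* Let $d\ge1$ and $N\ge2$ be integers and let $T^d_{2N}$ be the $d$-dimensional torus with vertex set $(\mathbb Z/2N\mathbb Z)^d$, where $(x_1,\dots,x_d)$ is adjacent to the $2d$ vertices obtained by changing exactly one coordinate by $\pm1$. Consider the two marked sets (each of size $(2N)^d/2$) Case 1: $M=\{(x_1,\dots,x_d)\mid x_1+\dots+x_d \text{ even}\}$; Case 2: $M=\{(x_1,\dots,x_d)\mid 0\le x_d\le N-1\}$ (representatives $x_i\in\{0,\dots,2N-1\}$), and let $W'_1$, $W'_2$ be the corresponding search time evolution matrices. Then for real $u\in(0,1)$: $$\zeta(W'_1,T^d_{2N},u)^{-1}=\lim_{N\to\infty}\zeta(W'_1,T^d_{2N},u)^{-1}=\exp\Big[\Big(2d-\tfrac12\Big)\log(1-u)+\log(1+u)\Big];$$ $$\zeta(W'_2,T^d_{2N},u)^{-1}=\exp\Big[\Big(2d-\tfrac12\Big)\log(1-u)+\frac{1}{(2N)^d}\sum_{k_1,\dots,k_{d-1}=1}^{2N}\sum_{k_d=1}^{N}\log\Big\{(1+u)^2-\frac{4u}{d^2}\Big(\sum_{i=1}^{d-1}\cos\frac{(k_i-1)\pi}{N}+\cos\frac{k_d\pi}{N+1}\Big)^2\Big\}\Big];$$ $$\lim_{N\to\infty}\zeta(W'_2,T^d_{2N},u)^{-1}=\exp\Big[\Big(2d-\tfrac12\Big)\log(1-u)+\frac12\int_{[0,2\pi)^d}\log\Big\{(1+u)^2-\frac{4u}{d^2}\Big(\sum_{i=1}^{d-1}\cos\theta_i+\cos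\frac{\theta_d}{2}\Big)^2\Big\}\frac{d\theta_1}{2\pi}\cdots\frac{d\theta_d}{2\pi}\Big].$$
   Context: Search time evolution matrix. Let $G=(X,E)$ be a connected simple graph with $\epsilon$ edges, $d_G(x)$ the degree of $x$, and $M_X\subset X$ a set of marked vertices, $|M_X|=m$. Let $Y=\{x'\mid x\in X\}$ be a disjoint copy of $X$, $M_Y=\{x'\mid x\in M_X\}$, $E'=\{\{x,y'\},\{x',y\}\mid\{x,y\}\in E\}$, $E_2=\{\{x,x'\}\mid x\in M_X\}$, $E_M=E'\cup E_2$ ($|E_M|=2\epsilon+m$). Define the $(2\epsilon+m)\times|X|$ matrix $K$ by $K_{e,x}=1/\sqrt{d_G(x)}$ if $x\in e$, $x\notin M_X$; $K_{e,x}=1$ if $x\in e$ and $e\in E_2$; $0$ otherwise; and $L$ (columns indexed by $Y$) by $L_{e,x'}=1/\sqrt{d_G(x)}$ if $x'\in e$, $x'\notin M_Y$; $1$ if $x'\in e$ and $e\in E_2$; $0$ otherwise. Then $W'=(2LL^\top-I_{2\epsilon+m})(2KK^\top-I_{2\epsilon+m})$. Here $G=T^d_{2N}$ ($\epsilon=d(2N)^d$) and $M_X=M$. Zeta function: $\zeta(U,T^d_{2N},u)=\det(I_{2d(2N)^d+m}-uU)^{-1/(2N)^d}$. *)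

theory Defs
  imports "HOL-Probability.Probability" "HOL-Combinatorics.Permutations"
begin

(* A simple graph G = (X, adj) given by a vertex set X and a symmetric irreflexive
   adjacency relation adj; M is the set of marked vertices.
   The copy Y of X is represented by Inr, X itself by Inl. *)

definition gdeg :: "'a set \<Rightarrow> ('a \<Rightarrow> 'a \<Rightarrow> bool) \<Rightarrow> 'a \<Rightarrow> nat" where
  "gdeg X adj x = card {y \<in> X. adj x y}"

(* E' = {{x,y'},{x',y} | {x,y} in E}; since adj is symmetric this is {{x,y'} | x adj y} *)
definition Eprime :: "'a set \<Rightarrow> ('a \<Rightarrow> 'a \<Rightarrow> bool) \<Rightarrow> ('a + 'a) set set" where
  "Eprime X adj = {{Inl x, Inr y} | x y. x \<in> X \<and> y \<in> X \<and> adj x y}"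

definition E2 :: "'a set \<Rightarrow> ('a + 'a) set set" where
  "E2 M = {{Inl x, Inr x} | x. x \<in> M}"

definition EM :: "'a set \<Rightarrow> ('a \<Rightarrow> 'a \<Rightarrow> bool) \<Rightarrow> 'a set \<Rightarrow> ('a + 'a) set set" where
  "EM X adj M = Eprime X adj \<union> E2 M"

definition Kmat :: "'a set \<Rightarrow> ('a \<Rightarrow> 'a \<Rightarrow> bool) \<Rightarrow> 'a set \<Rightarrow> ('a + 'a) set \<Rightarrow> 'a \<Rightarrow> real" where
  "Kmat X adj M e x =
     (if Inl x \<in> e \<and> x \<notin> M then 1 / sqrt (real (gdeg X adj x))
      else if Inl x \<in> e \<and> e \<in> E2 M then 1 else 0)"

(* columns indexed by Y = {x'}: column x' is represented by x *)
definition Lmat :: "'a set \<Rightarrow> ('a \<Rightarrow> 'a \<Rightarrow> bool) \<Rightarrow> 'a set \<Rightarrow> ('a + 'a) set \<Rightarrow> 'a \<Rightarrow> real" where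
  "Lmat X adj M e x =
     (if Inr x \<in> e \<and> x \<notin> M then 1 / sqrt (real (gdeg X adj x))
      else if Inr x \<in> e \<and> e \<in> E2 M then 1 else 0)"

definition kd :: "'b \<Rightarrow> 'b \<Rightarrow> real" where
  "kd e f = (if e = f then 1 else 0)"

definition Wsearch :: "'a set \<Rightarrow> ('a \<Rightarrow> 'a \<Rightarrow> bool) \<Rightarrow> 'a set \<Rightarrow> ('a + 'a) set \<Rightarrow> ('a + 'a) set \<Rightarrow> real" where
  "Wsearch X adj M e f =
     (\<Sum>g\<in>EM X adj M.
        (2 * (\<Sum>x\<in>X. Lmat X adj M e x * Lmat X adj M g x) - kd e g) *
        (2 * (\<Sum>x\<in>X. Kmat X adj M g x * Kmat X adj M f x) - kd g f))"

definition det_on :: "'b set \<Rightarrow> ('b \<Rightarrow> 'b \<Rightarrow> real) \<Rightarrow> real" where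
  "det_on S A = (\<Sum>p | p permutes S. of_int (sign p) * (\<Prod>i\<in>S. A i (p i)))"

definition torusV :: "nat \<Rightarrow> nat \<Rightarrow> (nat \<Rightarrow> nat) set" where
  "torusV d n = PiE {..<d} (\<lambda>_. {..<n})"

definition torus_adj :: "nat \<Rightarrow> nat \<Rightarrow> (nat \<Rightarrow> nat) \<Rightarrow> (nat \<Rightarrow> nat) \<Rightarrow> bool" where
  "torus_adj d n x y \<longleftrightarrow>
     (\<exists>i<d. (y i = (x i + 1) mod n \<or> x i = (y i + 1) mod n) \<and> (\<forall>j<d. j \<noteq> i \<longrightarrow> x j = y j))"

definition zeta_inv_torus :: "nat \<Rightarrow> nat \<Rightarrow> (nat \<Rightarrow> nat) set \<Rightarrow> real \<Rightarrow> real" where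
  "zeta_inv_torus d N M u =
     (let X = torusV d (2*N); adj = torus_adj d (2*N) in
      det_on (EM X adj M) (\<lambda>e f. kd e f - u * Wsearch X adj M e f) powr (1 / real ((2*N)^d)))"

definition Mcase1 :: "nat \<Rightarrow> nat \<Rightarrow> (nat \<Rightarrow> nat) set" where
  "Mcase1 d N = {x \<in> torusV d (2*N). even (\<Sum>i<d. x i)}"

definition Mcase2 :: "nat \<Rightarrow> nat \<Rightarrow> (nat \<Rightarrow> nat) set" where
  "Mcase2 d N = {x \<in> torusV d (2*N). x (d - 1) \<le> N - 1}"

end

theory Submission
  imports Defs "Jordan_Normal_Form.Determinant"
begin

text \<open>The columns of \<open>K\<close> and of \<open>L\<close> are orthonormal, so \<open>W'\<close> is a product of two reflections. A
  Sylvester-type determinant identity reduces \<open>det (I - u W')\<close> to a power of \<open>1 - u\<close> times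
  \<open>det ((1 + u)\<^sup>2 I - 4 u C C\<^sup>T)\<close>, where \<open>C\<close> is the product of the transpose of \<open>L\<close> with \<open>K\<close>. The
  matrix \<open>C\<close> is the identity on the marked vertices and the transition matrix of the simple random
  walk killed at marked vertices on the others. In Case 1 no two unmarked vertices are adjacent,
  so the second block vanishes. In Case 2 the unmarked vertices span the product of a path on \<open>N\<close>
  vertices with a torus of dimension \<open>d - 1\<close>, whose adjacency matrix is diagonalised by products of
  functions \<open>cos + sin\<close> on the cycles and of sines on the path. The normalised sum over the
  eigenvalues is a Riemann sum, which gives the limit.\<close>

section \<open>Determinants of products of two reflections\<close>

text \<open>A vector orthogonal to all columns of \<open>K\<close> and \<open>L\<close> is negated
  by both reflections, hence fixed by W': this is where the powers of 1 - u come from. With p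
  vertices, half of them marked, there are 2dp + p/2 edges. Passing from edges to two copies of the
  vertex set removes 2p factors 1 - u, and each marked vertex gives back (1 + u)^2 - 4u = (1 - u)^2,
  so p factors in all; the total is (2d - 1/2)p. The identities are kept free of division, so powers
  of 1 - u stand on both sides until logarithms are taken. All determinants are real, so the
  eigenfunctions are chosen real too, and explicit orthogonal families of the right size take the
  place of a spectral theorem. In Case 2 the marking cuts one cycle into a path whose frequencies,
  multiples of \<pi>/(N+1) in (0, \<pi>), fill only half a period and do not form a grid of N equal
  cells. This forces a Riemann sum with free nodes, and it is the origin of the half angle in the
  limit.\<close>

lemma det_smult_one_minus_mult_commute:
  fixes A B :: "real mat"
  assumes A: "A \<in> carrier_mat n q" and B: "B \<in> carrier_mat q n"
  shows "a ^ q * Determinant.det (a \<cdot>\<^sub>m 1\<^sub>m n - A * B) = a ^ n * Determinant.det (a \<cdot>\<^sub>m 1\<^sub>m q - B * A)"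
proof -
  \<comment> \<open>The lower left block of \<open>M\<close> is cleared in two ways: by column
    operations \<open>R\<close>, leaving the Schur complement of \<open>1\<^sub>m q\<close>, and by
    row operations \<open>S\<close>, leaving that of \<open>a \<cdot>\<^sub>m 1\<^sub>m n\<close>.
    \<open>S\<close> scales the lower rows by \<open>a\<close> instead of dividing by it, so
    \<open>a = 0\<close> is covered.\<close>
  define M where "M = four_block_mat (a \<cdot>\<^sub>m 1\<^sub>m n) A B (1\<^sub>m q)"
  have M: "M \<in> carrier_mat (n + q) (n + q)"
    unfolding M_def by (intro four_block_carrier_mat) auto
  define R where "R = four_block_mat (1\<^sub>m n) (0\<^sub>m n q) (- B) (1\<^sub>m q)"
  define S where "S = four_block_mat (1\<^sub>m n) (0\<^sub>m n q) (- B) (a \<cdot>\<^sub>m 1\<^sub>m q)"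
  have R: "R \<in> carrier_mat (n + q) (n + q)" and S: "S \<in> carrier_mat (n + q) (n + q)"
    unfolding R_def S_def by (intro four_block_carrier_mat; simp)+
  have detR: "Determinant.det R = 1"
    unfolding R_def using B by (subst det_four_block_mat_upper_right_zero[where n = n and m = q]) auto
  have detS: "Determinant.det S = a ^ q"
    unfolding S_def using B by (subst det_four_block_mat_upper_right_zero[where n = n and m = q]) auto
  have "M * R = four_block_mat (a \<cdot>\<^sub>m 1\<^sub>m n - A * B) A (0\<^sub>m q n) (1\<^sub>m q)"
    unfolding M_def R_def using A B
    by (subst mult_four_block_mat[where ?nr1.0 = n and ?n1.0 = n and ?n2.0 = q and ?nr2.0 = q and ?nc1.0 = n and ?nc2.0 = q])
       (auto intro!: cong_four_block_mat eq_matI)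
  hence "Determinant.det (M * R) = Determinant.det (a \<cdot>\<^sub>m 1\<^sub>m n - A * B)"
    using A B by (simp, subst det_four_block_mat_lower_left_zero[where n = n and m = q]) auto
  hence MR: "Determinant.det M = Determinant.det (a \<cdot>\<^sub>m 1\<^sub>m n - A * B)"
    using det_mult[OF M R] detR by simp
  have "S * M = four_block_mat (a \<cdot>\<^sub>m 1\<^sub>m n) A (0\<^sub>m q n) (a \<cdot>\<^sub>m 1\<^sub>m q - B * A)"
    unfolding M_def S_def using A B
    by (subst mult_four_block_mat[where ?nr1.0 = n and ?n1.0 = n and ?n2.0 = q and ?nr2.0 = q and ?nc1.0 = n and ?nc2.0 = q])
       (auto intro!: cong_four_block_mat eq_matI)
  hence "Determinant.det (S * M) = a ^ n * Determinant.det (a \<cdot>\<^sub>m 1\<^sub>m q - B * A)"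
    using A B by (simp, subst det_four_block_mat_lower_left_zero[where n = n and m = q]) auto
  thus ?thesis
    using det_mult[OF S M] detS MR by simp
qed

text \<open>Up to the scalar part 1 - u, the matrix I - uW' differs from the identity by a product
  \<open>A * B\<close> through a space of dimension \<open>2 * p\<close>. Exchanging the factors
  gives a 2 x 2 block matrix whose blocks involve only \<open>C\<close>, because the columns of
  \<open>L\<close> and of \<open>K\<close> are orthonormal.\<close>

lemma det_one_minus_reflections:
  fixes L K :: "real mat"
  assumes L: "L \<in> carrier_mat n p" and K: "K \<in> carrier_mat n p"
    and LL: "transpose_mat L * L = 1\<^sub>m p" and KK: "transpose_mat K * K = 1\<^sub>m p"
  defines "C \<equiv> transpose_mat L * K"
  shows "(1 - u) ^ (2 * p) * Determinant.det (1\<^sub>m n - u \<cdot>\<^sub>m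
           ((2 \<cdot>\<^sub>m (L * transpose_mat L) - 1\<^sub>m n) * (2 \<cdot>\<^sub>m (K * transpose_mat K) - 1\<^sub>m n)))
       = (1 - u) ^ n * Determinant.det ((1 + u)\<^sup>2 \<cdot>\<^sub>m 1\<^sub>m p - (4 * u) \<cdot>\<^sub>m (C * transpose_mat C))"
proof -
  let ?T = transpose_mat
  have C: "C \<in> carrier_mat p p" and CT: "?T C = ?T K * L"
    unfolding C_def using L K by (auto simp: transpose_mult[of _ p n _ p])
  have tL: "?T L \<in> carrier_mat p n" and tK: "?T K \<in> carrier_mat p n" using L K by auto
  \<comment> \<open>Expanding the product of reflections gives 4LCK^T - 2LL^T - 2KK^T + I. After
    multiplication by \<open>u\<close>, \<open>X\<close> collects what stands to the right of a
    leading \<open>L\<close>, and \<open>Y\<close> what stands to the right of a leading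
    \<open>K\<close>.\<close>
  define X where "X = (4 * u) \<cdot>\<^sub>m (C * ?T K) - (2 * u) \<cdot>\<^sub>m ?T L"
  define Y where "Y = (- 2 * u) \<cdot>\<^sub>m ?T K"
  have X: "X \<in> carrier_mat p n" and Y: "Y \<in> carrier_mat p n"
    unfolding X_def Y_def using tL tK C by auto
  \<comment> \<open>The empty blocks present the block row (L K) and the block column of
    \<open>X\<close> and \<open>Y\<close> as four-block matrices.\<close>
  define A where "A = four_block_mat L K (0\<^sub>m 0 p) (0\<^sub>m 0 p)"
  define B where "B = four_block_mat X (0\<^sub>m p 0) Y (0\<^sub>m p 0)"
  have A: "A \<in> carrier_mat n (p + p)" and B: "B \<in> carrier_mat (p + p) n"
    unfolding A_def B_def using L K X Y by auto
  have AB: "A * B = L * X + K * Y"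
    unfolding A_def B_def using L K X Y
    by (subst mult_four_block_mat[where ?nr1.0 = n and ?n1.0 = p and ?n2.0 = p and ?nr2.0 = 0 and ?nc1.0 = n and ?nc2.0 = 0])
       (auto intro!: eq_matI)
  have BA: "B * A = four_block_mat (X * L) (X * K) (Y * L) (Y * K)"
    unfolding A_def B_def using L K X Y
    by (subst mult_four_block_mat[where ?nr1.0 = p and ?n1.0 = n and ?n2.0 = 0 and ?nr2.0 = p and ?nc1.0 = p and ?nc2.0 = p])
       (auto intro!: cong_four_block_mat)
  have LCK: "(L * ?T L) * (K * ?T K) = L * (C * ?T K)"
  proof -
    have "(L * ?T L) * (K * ?T K) = L * (?T L * (K * ?T K))"
      using L K tL tK by (intro assoc_mult_mat) auto
    also have "?T L * (K * ?T K) = C * ?T K"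
      unfolding C_def using L K tL tK by (intro assoc_mult_mat[symmetric]) auto
    finally show ?thesis .
  qed
  have prod: "(2 \<cdot>\<^sub>m (L * ?T L) - 1\<^sub>m n) * (2 \<cdot>\<^sub>m (K * ?T K) - 1\<^sub>m n)
     = 4 \<cdot>\<^sub>m (L * (C * ?T K)) - 2 \<cdot>\<^sub>m (L * ?T L) - (2 \<cdot>\<^sub>m (K * ?T K) - 1\<^sub>m n)" (is "(?a - _) * (?b - _) = _")
  proof -
    have c: "L * ?T L \<in> carrier_mat n n" "K * ?T K \<in> carrier_mat n n" using L K tL tK by auto
    have "(?a - 1\<^sub>m n) * (?b - 1\<^sub>m n) = ?a * (?b - 1\<^sub>m n) - 1\<^sub>m n * (?b - 1\<^sub>m n)"
      using c by (intro minus_mult_distrib_mat[of _ n n _ _ n]) auto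
    also have "?a * (?b - 1\<^sub>m n) = ?a * ?b - ?a * 1\<^sub>m n"
      using c by (intro mult_minus_distrib_mat[of _ n n _ n]) auto
    also have "?a * ?b = 2 \<cdot>\<^sub>m (2 \<cdot>\<^sub>m ((L * ?T L) * (K * ?T K)))"
      using c by (simp add: mult_smult_assoc_mat[of _ n n _ n] mult_smult_distrib[of _ n n _ n])
    also have "\<dots> = 4 \<cdot>\<^sub>m (L * (C * ?T K))"
      unfolding LCK by (intro eq_matI) auto
    also have "?a * 1\<^sub>m n = ?a" using c by auto
    also have "1\<^sub>m n * (?b - 1\<^sub>m n) = ?b - 1\<^sub>m n" using c by auto
    finally show ?thesis .
  qed
  have LX: "L * X = (4 * u) \<cdot>\<^sub>m (L * (C * ?T K)) - (2 * u) \<cdot>\<^sub>m (L * ?T L)"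
    unfolding X_def using L C tK tL
    by (subst mult_minus_distrib_mat[of _ n p _ n])
       (auto simp: mult_smult_distrib[of _ n p _ n])
  have KY: "K * Y = (- 2 * u) \<cdot>\<^sub>m (K * ?T K)"
    unfolding Y_def using K tK by (simp add: mult_smult_distrib[of _ n p _ n])
  have lhs: "1\<^sub>m n - u \<cdot>\<^sub>m ((2 \<cdot>\<^sub>m (L * ?T L) - 1\<^sub>m n) * (2 \<cdot>\<^sub>m (K * ?T K) - 1\<^sub>m n))
      = (1 - u) \<cdot>\<^sub>m 1\<^sub>m n - A * B"
    unfolding prod AB LX KY using L K C
    by (intro eq_matI) (auto simp: algebra_simps)
  have XL: "X * L = (4 * u) \<cdot>\<^sub>m (C * ?T C) - (2 * u) \<cdot>\<^sub>m 1\<^sub>m p"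
  proof -
    have "X * L = (4 * u) \<cdot>\<^sub>m (C * ?T K) * L - (2 * u) \<cdot>\<^sub>m ?T L * L"
      unfolding X_def using L tK tL C by (intro minus_mult_distrib_mat[of _ p n _ _ p]) auto
    also have "\<dots> = (4 * u) \<cdot>\<^sub>m ((C * ?T K) * L) - (2 * u) \<cdot>\<^sub>m (?T L * L)"
      using L tK tL C by (simp add: mult_smult_assoc_mat[of _ p n _ p])
    also have "(C * ?T K) * L = C * ?T C"
      unfolding CT using L tK C by (intro assoc_mult_mat) auto
    finally show ?thesis by (simp add: LL)
  qed
  have XK: "X * K = (2 * u) \<cdot>\<^sub>m C"
  proof -
    have "X * K = (4 * u) \<cdot>\<^sub>m (C * ?T K) * K - (2 * u) \<cdot>\<^sub>m ?T L * K"
      unfolding X_def using K tK tL C by (intro minus_mult_distrib_mat[of _ p n _ _ p]) auto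
    also have "\<dots> = (4 * u) \<cdot>\<^sub>m ((C * ?T K) * K) - (2 * u) \<cdot>\<^sub>m (?T L * K)"
      using K tK tL C by (simp add: mult_smult_assoc_mat[of _ p n _ p])
    also have "(C * ?T K) * K = C * (?T K * K)"
      using K tK C by (intro assoc_mult_mat) auto
    also have "\<dots> = C" using C by (simp add: KK)
    also have "?T L * K = C" by (simp add: C_def)
    finally show ?thesis using C by (auto intro!: eq_matI)
  qed
  have YL: "Y * L = (- 2 * u) \<cdot>\<^sub>m ?T C"
    unfolding Y_def CT using L tK by (simp add: mult_smult_assoc_mat[of _ p n _ p])
  have YK: "Y * K = (- 2 * u) \<cdot>\<^sub>m 1\<^sub>m p"
    unfolding Y_def using K tK by (simp add: mult_smult_assoc_mat[of _ p n _ p] KK)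
  have "(1 - u) \<cdot>\<^sub>m 1\<^sub>m (p + p) - B * A
     = four_block_mat ((1 + u) \<cdot>\<^sub>m 1\<^sub>m p - (4 * u) \<cdot>\<^sub>m (C * ?T C)) ((- 2 * u) \<cdot>\<^sub>m C)
         ((2 * u) \<cdot>\<^sub>m ?T C) ((1 + u) \<cdot>\<^sub>m 1\<^sub>m p)" (is "_ = four_block_mat ?P ?Q ?R ?S")
    unfolding BA XL XK YL YK using C
    by (intro eq_matI) (auto simp: algebra_simps)
  \<comment> \<open>\<open>?S\<close> is a scalar matrix, so it commutes with \<open>?R\<close>, and
    the block determinant is that of PS - QR.\<close>
  also have "Determinant.det \<dots> = Determinant.det (?P * ?S - ?Q * ?R)"
  proof (rule det_four_block_mat)
    have R: "?R \<in> carrier_mat p p" using C by auto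
    have "?R * ?S = (1 + u) \<cdot>\<^sub>m (?R * 1\<^sub>m p)" using R by (intro mult_smult_distrib[of _ p p _ p]) auto
    also have "\<dots> = (1 + u) \<cdot>\<^sub>m (1\<^sub>m p * ?R)"
      by (simp only: left_mult_one_mat[OF R] right_mult_one_mat[OF R])
    also have "\<dots> = ?S * ?R" using R by (intro mult_smult_assoc_mat[of _ p p _ p, symmetric]) auto
    finally show "?R * ?S = ?S * ?R" .
  qed (use C in auto)
  \<comment> \<open>The terms in \<open>C * ?T C\<close> combine through 4u(1 + u) - 4u^2 =
    4u.\<close>
  also have "?P * ?S - ?Q * ?R = (1 + u)\<^sup>2 \<cdot>\<^sub>m 1\<^sub>m p - (4 * u) \<cdot>\<^sub>m (C * ?T C)"
  proof -
    have P: "?P \<in> carrier_mat p p" using C by auto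
    have "?P * ?S = (1 + u) \<cdot>\<^sub>m (?P * 1\<^sub>m p)" using P by (intro mult_smult_distrib[of _ p p _ p]) auto
    hence PS: "?P * ?S = (1 + u) \<cdot>\<^sub>m ?P"
      by (simp only: right_mult_one_mat[OF P])
    have QR: "?Q * ?R = (2 * u) \<cdot>\<^sub>m ((- 2 * u) \<cdot>\<^sub>m (C * ?T C))"
      using C by (simp add: mult_smult_assoc_mat[of _ p p _ p] mult_smult_distrib[of _ p p _ p])
    show ?thesis unfolding PS QR using C
      by (intro eq_matI) (auto simp: algebra_simps power2_eq_square)
  qed
  finally show ?thesis
    using det_smult_one_minus_mult_commute[OF A B, of "1 - u"] unfolding lhs by (simp add: mult_2)
qed

section \<open>Determinants over arbitrary finite index sets\<close>

lemma det_on_eq_det: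
  assumes f: "bij_betw f {0..<n} S"
  shows "det_on S A = Determinant.det (mat n n (\<lambda>(i, j). A (f i) (f j)))"
proof -
  let ?m = "map_permutation {0..<n} f"
  have inj: "inj_on f {0..<n}" and img: "f ` {0..<n} = S"
    using f by (auto simp: bij_betw_def)
  have m: "?m p x = (if x \<in> S then f (p (inv_into {0..<n} f x)) else x)" for p x
    by (simp add: map_permutation_def restrict_id_def img)
  have "bij_betw ?m {p. p permutes {0..<n}} {p. p permutes S}"
    using bij_betw_permutations[OF f] by (simp add: m[abs_def])
  hence "det_on S A = (\<Sum>p | p permutes {0..<n}. of_int (sign (?m p)) * (\<Prod>i\<in>S. A i (?m p i)))"
    unfolding det_on_def by (rule sum.reindex_bij_betw[symmetric])
  also have "\<dots> = (\<Sum>p | p permutes {0..<n}. of_int (sign p) *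
      (\<Prod>i = 0..<n. mat n n (\<lambda>(i, j). A (f i) (f j)) $$ (i, p i)))"
  proof (intro sum.cong refl arg_cong2[where f = "(*)"])
    fix p assume "p \<in> {p. p permutes {0..<n}}"
    hence p: "p permutes {0..<n}" by simp
    show "real_of_int (sign (?m p)) = of_int (sign p)"
      using inj p by (simp add: sign_map_permutation)
    have "(\<Prod>i\<in>S. A i (?m p i)) = (\<Prod>i = 0..<n. A (f i) (?m p (f i)))"
      using f by (rule prod.reindex_bij_betw[symmetric])
    also have "\<dots> = (\<Prod>i = 0..<n. mat n n (\<lambda>(i, j). A (f i) (f j)) $$ (i, p i))"
    proof (intro prod.cong refl)
      fix i assume i: "i \<in> {0..<n}"
      hence "p i \<in> {0..<n}" using permutes_in_image[OF p] by blast
      with i show "A (f i) (?m p (f i)) = mat n n (\<lambda>(i, j). A (f i) (f j)) $$ (i, p i)"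
        using inj by (simp add: map_permutation_apply)
    qed
    finally show "(\<Prod>i\<in>S. A i (?m p i)) = (\<Prod>i = 0..<n. mat n n (\<lambda>(i, j). A (f i) (f j)) $$ (i, p i))" .
  qed
  finally show ?thesis by (simp only: det_def'[OF mat_carrier])
qed

text \<open>With the \<open>F k\<close> as rows of \<open>MF\<close>, the eigenvalue equations read
  \<open>MF * MA = D * MF\<close>. Taking determinants, only the nonvanishing of
  \<open>det MF\<close> is missing, and orthogonality supplies it; no inverse of \<open>MF\<close>
  has to be constructed.\<close>

lemma det_on_eq_prod_eigenvalues:
  assumes S: "finite S" and T: "finite T" and card: "card T = card S"
    and eigen: "\<And>k y. k \<in> T \<Longrightarrow> y \<in> S \<Longrightarrow> (\<Sum>x\<in>S. F k x * A x y) = \<mu> k * F k y"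
    and orth: "\<And>k l. k \<in> T \<Longrightarrow> l \<in> T \<Longrightarrow> k \<noteq> l \<Longrightarrow> (\<Sum>x\<in>S. F k x * F l x) = 0"
    and norm: "\<And>k. k \<in> T \<Longrightarrow> (\<Sum>x\<in>S. F k x * F k x) \<noteq> 0"
  shows "det_on S A = (\<Prod>k\<in>T. \<mu> k)"
proof -
  define n where "n = card S"
  obtain f where f: "bij_betw f {0..<n} S" using ex_bij_betw_nat_finite[OF S] n_def by auto
  obtain g where g: "bij_betw g {0..<n} T" using ex_bij_betw_nat_finite[OF T] n_def card by auto
  have fS: "f i \<in> S" if "i < n" for i using f that by (auto simp: bij_betw_def)
  have gT: "g i \<in> T" if "i < n" for i using g that by (auto simp: bij_betw_def)
  have g_eq: "g i = g j \<longleftrightarrow> i = j" if "i < n" "j < n" for i j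
    using g that by (auto simp: bij_betw_def inj_on_def)
  have sum_f: "(\<Sum>i = 0..<n. h (f i)) = (\<Sum>x\<in>S. h x)" for h :: "'a \<Rightarrow> real"
    using f by (rule sum.reindex_bij_betw)
  define MA where "MA = mat n n (\<lambda>(i, j). A (f i) (f j))"
  define MF where "MF = mat n n (\<lambda>(i, j). F (g i) (f j))"
  define D where "D = mat n n (\<lambda>(i, j). if i = j then \<mu> (g i) else 0)"
  define G where "G = mat n n (\<lambda>(i, j). if i = j then (\<Sum>x\<in>S. F (g i) x * F (g i) x) else 0)"
  have car: "MA \<in> carrier_mat n n" "MF \<in> carrier_mat n n" "D \<in> carrier_mat n n" "G \<in> carrier_mat n n"
    by (auto simp: MA_def MF_def D_def G_def)
  have det_diag: "Determinant.det (mat n n (\<lambda>(i, j). if i = j then h i else 0)) = (\<Prod>i = 0..<n. h i)"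
    for h :: "nat \<Rightarrow> real"
    by (subst det_upper_triangular[where n = n]) (auto simp: prod_list_diag_prod)
  have "MF * MA = D * MF"
  proof (intro eq_matI)
    fix i j assume "i < dim_row (D * MF)" "j < dim_col (D * MF)"
    hence ij: "i < n" "j < n" using car by auto
    have "(MF * MA) $$ (i, j) = (\<Sum>k = 0..<n. F (g i) (f k) * A (f k) (f j))"
      using ij by (simp add: MF_def MA_def scalar_prod_def)
    also have "\<dots> = \<mu> (g i) * F (g i) (f j)"
      using ij by (simp add: sum_f[of "\<lambda>x. F (g i) x * A x (f j)"] eigen fS gT)
    also have "\<dots> = (D * MF) $$ (i, j)"
      using ij by (simp add: MF_def D_def scalar_prod_def if_distrib[of "\<lambda>a. a * _"] cong: if_cong)
    finally show "(MF * MA) $$ (i, j) = (D * MF) $$ (i, j)" .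
  qed (use car in auto)
  hence "Determinant.det MF * Determinant.det MA = Determinant.det D * Determinant.det MF"
    using det_mult car by metis
  \<comment> \<open>The Gram matrix is diagonal with nonzero entries, so the square of the
    determinant of \<open>MF\<close> is nonzero and the factor can be cancelled.\<close>
  moreover have "MF * transpose_mat MF = G"
  proof (intro eq_matI)
    fix i j assume "i < dim_row G" "j < dim_col G"
    hence ij: "i < n" "j < n" using car by auto
    have "(MF * transpose_mat MF) $$ (i, j) = (\<Sum>k = 0..<n. F (g i) (f k) * F (g j) (f k))"
      using ij by (simp add: MF_def scalar_prod_def)
    also have "\<dots> = G $$ (i, j)"
      using ij by (simp add: sum_f[of "\<lambda>x. F (g i) x * F (g j) x"] orth gT g_eq G_def)
    finally show "(MF * transpose_mat MF) $$ (i, j) = G $$ (i, j)" .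
  qed (use car in auto)
  hence "Determinant.det MF * Determinant.det MF = Determinant.det G"
    using det_mult[of MF n "transpose_mat MF"] car by (simp add: det_transpose[of MF n])
  moreover have "Determinant.det G \<noteq> 0"
    unfolding G_def det_diag using norm gT by simp
  ultimately have "Determinant.det MA = Determinant.det D" by auto
  also have "\<dots> = (\<Prod>k\<in>T. \<mu> k)"
    unfolding D_def det_diag using g by (rule prod.reindex_bij_betw)
  finally show ?thesis unfolding det_on_eq_det[OF f] MA_def .
qed

lemma det_on_one_minus_reflections:
  fixes L K :: "'e \<Rightarrow> 'x \<Rightarrow> real"
  assumes E: "finite E" and X: "finite X"
    and LL: "\<And>x y. x \<in> X \<Longrightarrow> y \<in> X \<Longrightarrow> (\<Sum>e\<in>E. L e x * L e y) = kd x y"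
    and KK: "\<And>x y. x \<in> X \<Longrightarrow> y \<in> X \<Longrightarrow> (\<Sum>e\<in>E. K e x * K e y) = kd x y"
    and C: "\<And>x y. x \<in> X \<Longrightarrow> y \<in> X \<Longrightarrow> (\<Sum>e\<in>E. L e x * K e y) = C x y"
  shows "(1 - u) ^ (2 * card X) * det_on E (\<lambda>e f. kd e f - u * (\<Sum>g\<in>E.
            (2 * (\<Sum>x\<in>X. L e x * L g x) - kd e g) * (2 * (\<Sum>x\<in>X. K g x * K f x) - kd g f)))
       = (1 - u) ^ card E *
         det_on X (\<lambda>x y. (1 + u)\<^sup>2 * kd x y - 4 * u * (\<Sum>z\<in>X. C x z * C y z))"
proof -
  define n where "n = card E"
  define p where "p = card X"
  obtain f where f: "bij_betw f {0..<n} E" using ex_bij_betw_nat_finite[OF E] n_def by auto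
  obtain g where g: "bij_betw g {0..<p} X" using ex_bij_betw_nat_finite[OF X] p_def by auto
  have gX: "g i \<in> X" if "i < p" for i using g that by (auto simp: bij_betw_def)
  have kdf: "kd (f i) (f j) = (if i = j then 1 else 0)" if "i < n" "j < n" for i j
    using f that by (auto simp: bij_betw_def inj_on_def kd_def)
  have kdg: "kd (g i) (g j) = (if i = j then 1 else 0)" if "i < p" "j < p" for i j
    using g that by (auto simp: bij_betw_def inj_on_def kd_def)
  have sum_f: "(\<Sum>i = 0..<n. h (f i)) = (\<Sum>x\<in>E. h x)" for h :: "'e \<Rightarrow> real"
    using f by (rule sum.reindex_bij_betw)
  have sum_g: "(\<Sum>i = 0..<p. h (g i)) = (\<Sum>x\<in>X. h x)" for h :: "'x \<Rightarrow> real"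
    using g by (rule sum.reindex_bij_betw)
  define LM where "LM = mat n p (\<lambda>(i, j). L (f i) (g j))"
  define KM where "KM = mat n p (\<lambda>(i, j). K (f i) (g j))"
  have car: "LM \<in> carrier_mat n p" "KM \<in> carrier_mat n p" by (auto simp: LM_def KM_def)
  have LLM: "transpose_mat LM * LM = 1\<^sub>m p"
    by (intro eq_matI) (auto simp: LM_def scalar_prod_def sum_f[of "\<lambda>e. L e _ * L e _"] LL gX kdg)
  have KKM: "transpose_mat KM * KM = 1\<^sub>m p"
    by (intro eq_matI) (auto simp: KM_def scalar_prod_def sum_f[of "\<lambda>e. K e _ * K e _"] KK gX kdg)
  have MC: "transpose_mat LM * KM = mat p p (\<lambda>(i, j). C (g i) (g j))"
    by (intro eq_matI) (auto simp: LM_def KM_def scalar_prod_def sum_f[of "\<lambda>e. L e _ * K e _"] C gX)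
  have RL: "2 \<cdot>\<^sub>m (LM * transpose_mat LM) - 1\<^sub>m n
      = mat n n (\<lambda>(i, j). 2 * (\<Sum>x\<in>X. L (f i) x * L (f j) x) - kd (f i) (f j))"
    by (intro eq_matI) (auto simp: LM_def scalar_prod_def sum_g[of "\<lambda>x. L _ x * L _ x"] kdf)
  have RK: "2 \<cdot>\<^sub>m (KM * transpose_mat KM) - 1\<^sub>m n
      = mat n n (\<lambda>(i, j). 2 * (\<Sum>x\<in>X. K (f i) x * K (f j) x) - kd (f i) (f j))"
    by (intro eq_matI) (auto simp: KM_def scalar_prod_def sum_g[of "\<lambda>x. K _ x * K _ x"] kdf)
  have W: "1\<^sub>m n - u \<cdot>\<^sub>m ((2 \<cdot>\<^sub>m (LM * transpose_mat LM) - 1\<^sub>m n) * (2 \<cdot>\<^sub>m (KM * transpose_mat KM) - 1\<^sub>m n))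
     = mat n n (\<lambda>(i, j). kd (f i) (f j) - u * (\<Sum>h\<in>E.
         (2 * (\<Sum>x\<in>X. L (f i) x * L h x) - kd (f i) h) * (2 * (\<Sum>x\<in>X. K h x * K (f j) x) - kd h (f j))))"
    unfolding RL RK
    by (intro eq_matI)
       (auto simp: scalar_prod_def kdf[symmetric] sum_f[of "\<lambda>h. (2 * (\<Sum>x\<in>X. L _ x * L h x) - kd _ h)
          * (2 * (\<Sum>x\<in>X. K h x * K _ x) - kd h _)", symmetric])
  have CC: "(1 + u)\<^sup>2 \<cdot>\<^sub>m 1\<^sub>m p - (4 * u) \<cdot>\<^sub>m ((transpose_mat LM * KM) * transpose_mat (transpose_mat LM * KM))
     = mat p p (\<lambda>(i, j). (1 + u)\<^sup>2 * kd (g i) (g j) - 4 * u * (\<Sum>z\<in>X. C (g i) z * C (g j) z))"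
    unfolding MC
    by (intro eq_matI) (auto simp: scalar_prod_def sum_g[of "\<lambda>z. C _ z * C _ z"] kdg)
  show ?thesis
    using det_one_minus_reflections[OF car LLM KKM, of u]
    unfolding W CC det_on_eq_det[OF f] det_on_eq_det[OF g] n_def[symmetric] p_def[symmetric] .
qed

section \<open>The search walk on a graph\<close>

text \<open>The pair (x, y) stands for the edge joining x to the copy of y. An edge of the graph
  thus yields two arcs, and a diagonal pair is the extra edge of a marked vertex.\<close>

definition arcs :: "'a set \<Rightarrow> ('a \<Rightarrow> 'a \<Rightarrow> bool) \<Rightarrow> 'a set \<Rightarrow> ('a \<times> 'a) set" where
  "arcs X adj M = {(x, y) \<in> X \<times> X. adj x y \<or> x = y \<and> x \<in> M}"

lemma bij_betw_arcs_EM: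
  assumes "M \<subseteq> X"
  shows "bij_betw (\<lambda>(x, y). {Inl x, Inr y}) (arcs X adj M) (EM X adj M)"
  unfolding bij_betw_def
proof
  show "inj_on (\<lambda>(x, y). {Inl x, Inr y}) (arcs X adj M)"
    by (auto simp: inj_on_def doubleton_eq_iff)
  show "(\<lambda>(x, y). {Inl x, Inr y}) ` arcs X adj M = EM X adj M"
    using assms by (auto simp: EM_def Eprime_def E2_def arcs_def image_iff)
qed

lemma sum_EM:
  fixes h :: "('a + 'a) set \<Rightarrow> real"
  assumes "finite X" "M \<subseteq> X"
  shows "(\<Sum>e\<in>EM X adj M. h e)
    = (\<Sum>x\<in>X. \<Sum>y\<in>X. if adj x y \<or> x = y \<and> x \<in> M then h {Inl x, Inr y} else 0)"
proof -
  have "(\<Sum>e\<in>EM X adj M. h e) = (\<Sum>(x, y)\<in>arcs X adj M. h {Inl x, Inr y})"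
    using sum.reindex_bij_betw[OF bij_betw_arcs_EM[OF assms(2), of adj], of h] by (simp add: case_prod_unfold)
  also have "\<dots> = (\<Sum>(x, y)\<in>X \<times> X. if adj x y \<or> x = y \<and> x \<in> M then h {Inl x, Inr y} else 0)"
    using assms by (intro sum.mono_neutral_cong_left) (auto simp: arcs_def split: if_splits)
  finally show ?thesis by (simp add: sum.cartesian_product)
qed

text \<open>An edge has one endpoint in each copy of the vertex set, so a row of \<open>K\<close> or
  of \<open>L\<close> has at most one nonzero entry; this is its value.\<close>

definition amp :: "'a set \<Rightarrow> ('a \<Rightarrow> 'a \<Rightarrow> bool) \<Rightarrow> 'a set \<Rightarrow> 'a \<Rightarrow> 'a \<Rightarrow> real" where
  "amp X adj M x y = (if x \<notin> M then 1 / sqrt (real (gdeg X adj x)) else if x = y then 1 else 0)"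

lemma Kmat_edge: "Kmat X adj M {Inl x, Inr y} z = (if x = z then amp X adj M x y else 0)"
  by (auto simp: Kmat_def amp_def E2_def doubleton_eq_iff)

lemma Lmat_edge: "Lmat X adj M {Inl x, Inr y} z = (if y = z then amp X adj M y x else 0)"
  by (auto simp: Lmat_def amp_def E2_def doubleton_eq_iff)

text \<open>Columns have unit length: a marked vertex puts its whole weight on the edge to its own
  copy, while an unmarked one gives weight 1/deg to each neighbour.\<close>

lemma sum_amp_squares:
  assumes X: "finite X" and "x \<in> X" and irr: "\<not> adj x x" and deg: "x \<notin> M \<Longrightarrow> 0 < gdeg X adj x"
  shows "(\<Sum>y\<in>X. if adj x y \<or> x = y \<and> x \<in> M then amp X adj M x y * amp X adj M x y else 0) = 1"
proof (cases "x \<in> M")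
  case True
  have "(\<Sum>y\<in>X. if adj x y \<or> x = y \<and> x \<in> M then amp X adj M x y * amp X adj M x y else 0)
      = (\<Sum>y\<in>X. if x = y then 1 else 0)"
    using True by (intro sum.cong) (auto simp: amp_def)
  thus ?thesis using assms by simp
next
  case False
  have "(\<Sum>y\<in>X. if adj x y \<or> x = y \<and> x \<in> M then amp X adj M x y * amp X adj M x y else 0)
      = (\<Sum>y | y \<in> X \<and> adj x y. 1 / real (gdeg X adj x))"
    unfolding sum.inter_filter[OF X] using False by (intro sum.cong) (auto simp: amp_def)
  also have "\<dots> = 1"
    using deg[OF False] by (simp add: gdeg_def)
  finally show ?thesis .
qed

text \<open>The matrix product \<open>C\<close> of the transpose of \<open>L\<close> with \<open>K\<close>.\<close>
definition disc :: "'a set \<Rightarrow> ('a \<Rightarrow> 'a \<Rightarrow> bool) \<Rightarrow> 'a set \<Rightarrow> 'a \<Rightarrow> 'a \<Rightarrow> real" where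
  "disc X adj M x y =
     (if x \<in> M \<or> y \<in> M then kd x y
      else if adj x y then 1 / (sqrt (real (gdeg X adj x)) * sqrt (real (gdeg X adj y))) else 0)"

text \<open>Since the marked block of \<open>C\<close> is the identity, eigenfunctions are required
  on the unmarked vertices only, extended by zero. Orthogonality together with \<open>cardJ\<close>
  makes the family complete, so no multiplicities have to be tracked.\<close>

lemma det_search_walk:
  fixes v :: "'k \<Rightarrow> 'a \<Rightarrow> real"
  assumes X: "finite X" and M: "M \<subseteq> X"
    and sym: "\<And>x y. x \<in> X \<Longrightarrow> y \<in> X \<Longrightarrow> adj x y \<Longrightarrow> adj y x"
    and irr: "\<And>x. x \<in> X \<Longrightarrow> \<not> adj x x"
    and deg: "\<And>x. x \<in> X - M \<Longrightarrow> 0 < gdeg X adj x"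
    and J: "finite J" and cardJ: "card J = card (X - M)"
    and v0: "\<And>k x. k \<in> J \<Longrightarrow> x \<in> M \<Longrightarrow> v k x = 0"
    and eigen: "\<And>k x. k \<in> J \<Longrightarrow> x \<in> X - M \<Longrightarrow>
       (\<Sum>y | y \<in> X \<and> adj x y. v k y / (sqrt (real (gdeg X adj x)) * sqrt (real (gdeg X adj y)))) = \<mu> k * v k x"
    and orth: "\<And>k l. k \<in> J \<Longrightarrow> l \<in> J \<Longrightarrow> k \<noteq> l \<Longrightarrow> (\<Sum>x\<in>X. v k x * v l x) = 0"
    and norm: "\<And>k. k \<in> J \<Longrightarrow> (\<Sum>x\<in>X. v k x * v k x) \<noteq> 0"
  shows "(1 - u) ^ (2 * card X) * det_on (EM X adj M) (\<lambda>e f. kd e f - u * Wsearch X adj M e f)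
       = (1 - u) ^ (card (EM X adj M) + 2 * card M) * (\<Prod>k\<in>J. (1 + u)\<^sup>2 - 4 * u * (\<mu> k)\<^sup>2)"
proof -
  let ?E = "EM X adj M" and ?C = "disc X adj M"
  let ?R = "\<lambda>x y. adj x y \<or> x = y \<and> x \<in> M"
  let ?a = "amp X adj M"
  have finM: "finite M" using X M finite_subset by blast
  have E: "finite ?E"
    using bij_betw_finite[OF bij_betw_arcs_EM[OF M, of adj]] X
    by (auto simp: arcs_def intro: finite_subset[of _ "X \<times> X"])
  have R_sym: "?R x y \<longleftrightarrow> ?R y x" if "x \<in> X" "y \<in> X" for x y using sym that by blast
  have sq: "(\<Sum>y\<in>X. if ?R x y then ?a x y * ?a x y else 0) = 1" if "x \<in> X" for x
    using sum_amp_squares[of X x adj M] X that irr deg by auto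
  \<comment> \<open>Different columns of \<open>K\<close> have disjoint supports, so only the
    diagonal sums remain; the same holds for \<open>L\<close>.\<close>
  have KK: "(\<Sum>e\<in>?E. Kmat X adj M e x * Kmat X adj M e y) = kd x y" if xy: "x \<in> X" "y \<in> X" for x y
  proof -
    have "(\<Sum>e\<in>?E. Kmat X adj M e x * Kmat X adj M e y)
      = (\<Sum>a\<in>X. \<Sum>b\<in>X. if a = x then (if x = y \<and> ?R x b then ?a x b * ?a x b else 0) else 0)"
      unfolding sum_EM[OF X M] by (intro sum.cong refl) (auto simp: Kmat_edge)
    also have "\<dots> = (if x = y then \<Sum>b\<in>X. if ?R x b then ?a x b * ?a x b else 0 else 0)"
      using xy X by (subst sum.swap) (auto intro: sum.cong)
    finally show ?thesis using xy X sq by (cases "x = y") (auto simp: kd_def)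
  qed
  have LL: "(\<Sum>e\<in>?E. Lmat X adj M e x * Lmat X adj M e y) = kd x y" if xy: "x \<in> X" "y \<in> X" for x y
  proof -
    have "(\<Sum>e\<in>?E. Lmat X adj M e x * Lmat X adj M e y)
      = (\<Sum>a\<in>X. \<Sum>b\<in>X. if b = x then (if x = y \<and> ?R x a then ?a x a * ?a x a else 0) else 0)"
      unfolding sum_EM[OF X M] using R_sym xy by (intro sum.cong refl) (auto simp: Lmat_edge)
    also have "\<dots> = (if x = y then \<Sum>a\<in>X. if ?R x a then ?a x a * ?a x a else 0 else 0)"
      using xy X by (auto intro: sum.cong)
    finally show ?thesis using xy X sq by (cases "x = y") (auto simp: kd_def)
  qed
  \<comment> \<open>Only the edge from \<open>y\<close> to the copy of \<open>x\<close> meets both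
    columns. If just one of its ends is marked, the amplitude at that end is zero, which decouples
    marked from unmarked vertices.\<close>
  have C: "(\<Sum>e\<in>?E. Lmat X adj M e x * Kmat X adj M e y) = ?C x y" if xy: "x \<in> X" "y \<in> X" for x y
  proof -
    have "(\<Sum>e\<in>?E. Lmat X adj M e x * Kmat X adj M e y)
      = (\<Sum>a\<in>X. \<Sum>b\<in>X. if b = x then (if a = y then (if ?R x y then ?a x y * ?a y x else 0) else 0) else 0)"
      unfolding sum_EM[OF X M] using R_sym xy by (intro sum.cong refl) (auto simp: Lmat_edge Kmat_edge)
    also have "\<dots> = (if ?R x y then ?a x y * ?a y x else 0)"
      using xy X by simp
    also have "\<dots> = ?C x y"
      using irr xy by (auto simp: disc_def amp_def kd_def)
    finally show ?thesis .
  qed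
  have C_sym: "?C x y = ?C y x" if "x \<in> X" "y \<in> X" for x y
    using sym that by (auto simp: disc_def kd_def mult.commute)
  \<comment> \<open>Point masses at marked vertices, with eigenvalue 1, complete the given family to
    an eigenbasis of \<open>?C\<close>.\<close>
  define F where "F = (\<lambda>t x. case t of Inl m \<Rightarrow> kd m x | Inr k \<Rightarrow> v k x)"
  define \<nu> :: "'a + 'k \<Rightarrow> real" where "\<nu> = (\<lambda>t. case t of Inl m \<Rightarrow> 1 | Inr k \<Rightarrow> \<mu> k)"
  have FC: "(\<Sum>y\<in>X. F t y * ?C x y) = \<nu> t * F t x" if t: "t \<in> M <+> J" and x: "x \<in> X" for t x
  proof (cases t)
    case (Inl m)
    hence m: "m \<in> M" "m \<in> X" using t M by auto
    have "(\<Sum>y\<in>X. F t y * ?C x y) = (\<Sum>y\<in>X. if m = y then ?C x m else 0)"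
      unfolding Inl F_def by (intro sum.cong) (auto simp: kd_def)
    thus ?thesis using m X by (auto simp: Inl F_def \<nu>_def disc_def kd_def)
  next
    case (Inr k)
    hence k: "k \<in> J" using t by auto
    show ?thesis
    proof (cases "x \<in> M")
      case True
      have "(\<Sum>y\<in>X. F t y * ?C x y) = 0"
        using True v0[OF k] by (intro sum.neutral) (auto simp: Inr F_def disc_def kd_def)
      thus ?thesis using True v0[OF k] by (simp add: Inr F_def)
    next
      case False
      have "(\<Sum>y\<in>X. F t y * ?C x y) = (\<Sum>y\<in>X. if adj x y then
          v k y / (sqrt (real (gdeg X adj x)) * sqrt (real (gdeg X adj y))) else 0)"
        using False v0[OF k] by (intro sum.cong) (auto simp: Inr F_def disc_def kd_def)
      thus ?thesis using eigen[of k x] k x False X by (simp add: Inr F_def \<nu>_def sum.inter_filter)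
    qed
  qed
  have "det_on X (\<lambda>x y. (1 + u)\<^sup>2 * kd x y - 4 * u * (\<Sum>z\<in>X. ?C x z * ?C y z))
      = (\<Prod>t\<in>M <+> J. (1 + u)\<^sup>2 - 4 * u * (\<nu> t)\<^sup>2)"
  proof (rule det_on_eq_prod_eigenvalues[where F = F])
    show "card (M <+> J) = card X"
      using cardJ J finM X M by (simp add: card_Plus card_Diff_subset card_mono)
    show "(\<Sum>x\<in>X. F t x * ((1 + u)\<^sup>2 * kd x y - 4 * u * (\<Sum>z\<in>X. ?C x z * ?C y z)))
        = ((1 + u)\<^sup>2 - 4 * u * (\<nu> t)\<^sup>2) * F t y" if t: "t \<in> M <+> J" and y: "y \<in> X" for t y
    proof -
      have "(\<Sum>x\<in>X. F t x * ((1 + u)\<^sup>2 * kd x y)) = (\<Sum>x\<in>X. if x = y then (1 + u)\<^sup>2 * F t y else 0)"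
        by (intro sum.cong) (auto simp: kd_def)
      hence 1: "(\<Sum>x\<in>X. F t x * ((1 + u)\<^sup>2 * kd x y)) = (1 + u)\<^sup>2 * F t y"
        using X y by simp
      \<comment> \<open>By symmetry of \<open>?C\<close> its product with its transpose applies
        \<open>?C\<close> twice, so eigenvalues are squared.\<close>
      have "(\<Sum>x\<in>X. F t x * (\<Sum>z\<in>X. ?C x z * ?C y z)) = (\<Sum>z\<in>X. \<Sum>x\<in>X. F t x * ?C x z * ?C y z)"
        unfolding sum_distrib_left by (subst sum.swap) (simp add: mult.assoc)
      also have "\<dots> = (\<Sum>z\<in>X. (\<Sum>x\<in>X. F t x * ?C z x) * ?C y z)"
        using C_sym by (auto simp: sum_distrib_right intro!: sum.cong)
      also have "\<dots> = \<nu> t * (\<Sum>z\<in>X. F t z * ?C y z)"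
        using FC[OF t] by (simp add: sum_distrib_left mult.assoc)
      also have "\<dots> = (\<nu> t)\<^sup>2 * F t y"
        using FC[OF t y] by (simp add: power2_eq_square)
      finally have 2: "(\<Sum>x\<in>X. F t x * (\<Sum>z\<in>X. ?C x z * ?C y z)) = (\<nu> t)\<^sup>2 * F t y" .
      have "(\<Sum>x\<in>X. F t x * ((1 + u)\<^sup>2 * kd x y - 4 * u * (\<Sum>z\<in>X. ?C x z * ?C y z)))
         = (\<Sum>x\<in>X. F t x * ((1 + u)\<^sup>2 * kd x y)) - 4 * u * (\<Sum>x\<in>X. F t x * (\<Sum>z\<in>X. ?C x z * ?C y z))"
        by (simp add: right_diff_distrib sum_subtractf sum_distrib_left mult_ac)
      thus ?thesis unfolding 1 2 by (simp add: algebra_simps)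
    qed
    have kd_sum: "(\<Sum>x\<in>X. kd m x * h x) = h m" if "m \<in> M" for m and h :: "'a \<Rightarrow> real"
    proof -
      have "(\<Sum>x\<in>X. kd m x * h x) = (\<Sum>x\<in>X. if m = x then h m else 0)"
        by (intro sum.cong) (auto simp: kd_def)
      thus ?thesis using X M that by auto
    qed
    show "(\<Sum>x\<in>X. F s x * F t x) = 0" if "s \<in> M <+> J" "t \<in> M <+> J" "s \<noteq> t" for s t
      using that orth v0 by (auto simp: F_def kd_sum kd_sum[unfolded mult.commute[of "kd _ _"]])
        (auto simp: kd_def split: if_splits)
    show "(\<Sum>x\<in>X. F t x * F t x) \<noteq> 0" if "t \<in> M <+> J" for t
      using that norm by (auto simp: F_def kd_sum) (auto simp: kd_def)
  qed (use X J finM in auto)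
  also have "\<dots> = (\<Prod>m\<in>M. (1 + u)\<^sup>2 - 4 * u) * (\<Prod>k\<in>J. (1 + u)\<^sup>2 - 4 * u * (\<mu> k)\<^sup>2)"
    using finM J by (simp add: prod.Plus \<nu>_def)
  also have "(\<Prod>m\<in>M. (1 + u)\<^sup>2 - 4 * u) = (1 - u) ^ (2 * card M)"
  proof -
    have "(1 + u)\<^sup>2 - 4 * u = (1 - u)\<^sup>2" by (simp add: power2_eq_square algebra_simps)
    thus ?thesis by (simp add: power_mult)
  qed
  finally have "det_on X (\<lambda>x y. (1 + u)\<^sup>2 * kd x y - 4 * u * (\<Sum>z\<in>X. ?C x z * ?C y z))
     = (1 - u) ^ (2 * card M) * (\<Prod>k\<in>J. (1 + u)\<^sup>2 - 4 * u * (\<mu> k)\<^sup>2)" .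
  with det_on_one_minus_reflections[OF E X LL KK C, of u]
  show ?thesis unfolding Wsearch_def by (simp add: power_add)
qed

lemma card_EM_regular:
  assumes X: "finite X" and M: "M \<subseteq> X" and irr: "\<And>x. x \<in> X \<Longrightarrow> \<not> adj x x"
    and deg: "\<And>x. x \<in> X \<Longrightarrow> gdeg X adj x = r"
  shows "card (EM X adj M) = r * card X + card M"
proof -
  have finM: "finite M" using X M finite_subset by blast
  have "arcs X adj M = (SIGMA x:X. {y \<in> X. adj x y}) \<union> (\<lambda>x. (x, x)) ` M"
    using M by (auto simp: arcs_def)
  moreover have "(SIGMA x:X. {y \<in> X. adj x y}) \<inter> (\<lambda>x. (x, x)) ` M = {}"
    using irr by auto
  ultimately have "card (arcs X adj M) = (\<Sum>x\<in>X. gdeg X adj x) + card M"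
    using X finM by (simp add: card_Un_disjoint card_image inj_on_def gdeg_def)
  thus ?thesis
    using bij_betw_same_card[OF bij_betw_arcs_EM[OF M, of adj]] deg by simp
qed

section \<open>The torus\<close>

lemma mod_succ: "(a::nat) < n \<Longrightarrow> (a + 1) mod n = (if a + 1 = n then 0 else a + 1)"
  by auto

text \<open>The step -1 on the cycle is encoded as adding n - 1, so that subtraction of natural
  numbers never truncates.\<close>

lemma mod_pred: "(a::nat) < n \<Longrightarrow> (a + (n - 1)) mod n = (if a = 0 then n - 1 else a - 1)"
proof -
  assume "a < n"
  show ?thesis
  proof (cases "a = 0")
    case False
    hence "a + (n - 1) = (a - 1) + n" using \<open>a < n\<close> by simp
    hence "(a + (n - 1)) mod n = (a - 1) mod n" by (simp only: mod_add_self2)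
    thus ?thesis using False \<open>a < n\<close> by simp
  qed (use \<open>a < n\<close> in simp)
qed

lemma torusV_less: "x \<in> torusV d n \<Longrightarrow> i < d \<Longrightarrow> x i < n"
  by (auto simp: torusV_def)

lemma torus_adj_sym: "torus_adj d n x y \<Longrightarrow> torus_adj d n y x"
  unfolding torus_adj_def by metis

lemma torus_adj_irrefl:
  assumes "2 \<le> n" "x \<in> torusV d n"
  shows "\<not> torus_adj d n x x"
proof
  assume "torus_adj d n x x"
  then obtain i where i: "i < d" "x i = (x i + 1) mod n" by (auto simp: torus_adj_def)
  moreover have "x i < n" using assms i by (auto simp: torusV_def)
  ultimately show False using assms(1) mod_succ[of "x i" n] by (auto split: if_splits)
qed

lemma torus_neighbours:
  assumes x: "x \<in> torusV d n" and n: "0 < n"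
  shows "{y \<in> torusV d n. torus_adj d n x y} = (\<lambda>(i, s). x(i := (x i + s) mod n)) ` ({..<d} \<times> {1, n - 1})"
proof (intro equalityI subsetI)
  fix y assume "y \<in> {y \<in> torusV d n. torus_adj d n x y}"
  then obtain i where y: "y \<in> torusV d n" and i: "i < d"
    and adj: "y i = (x i + 1) mod n \<or> x i = (y i + 1) mod n" and eq: "\<And>j. j < d \<Longrightarrow> j \<noteq> i \<Longrightarrow> x j = y j"
    by (auto simp: torus_adj_def)
  have "x i < n" "y i < n" using x y i by (auto simp: torusV_def)
  hence "y i = (x i + 1) mod n \<or> y i = (x i + (n - 1)) mod n"
    using adj mod_succ[of "y i" n] mod_pred[of "x i" n] by (auto split: if_splits)
  then obtain s where s: "s \<in> {1, n - 1}" "y i = (x i + s) mod n" by blast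
  \<comment> \<open>Beyond \<open>d\<close> both functions are \<open>undefined\<close> by
    extensionality, so agreement below \<open>d\<close> suffices.\<close>
  have "y j = (x(i := y i)) j" for j
    using eq[of j] x y by (cases "j < d") (auto simp: torusV_def PiE_def extensional_def)
  hence "y = x(i := (x i + s) mod n)" using s(2) by auto
  thus "y \<in> (\<lambda>(i, s). x(i := (x i + s) mod n)) ` ({..<d} \<times> {1, n - 1})"
    using i s(1) by auto
next
  fix y assume "y \<in> (\<lambda>(i, s). x(i := (x i + s) mod n)) ` ({..<d} \<times> {1, n - 1})"
  then obtain i s where i: "i < d" and s: "s \<in> {1, n - 1}" and y: "y = x(i := (x i + s) mod n)" by auto
  have "y \<in> torusV d n" using x i n y by (auto simp: torusV_def PiE_def extensional_def)
  moreover have "x i < n" using x i by (auto simp: torusV_def)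
  hence "x i = ((x i + (n - 1)) mod n + 1) mod n"
    using mod_pred[of "x i" n] by auto
  hence "torus_adj d n x y"
    unfolding torus_adj_def using i s y by (intro exI[of _ i]) auto
  ultimately show "y \<in> {y \<in> torusV d n. torus_adj d n x y}" by simp
qed

text \<open>The bound on \<open>n\<close> is essential: for \<open>n = 2\<close> the steps +1 and -1
  reach the same vertex, which the neighbour set counts once and the right-hand side twice.\<close>

lemma sum_torus_neighbours:
  fixes f :: "(nat \<Rightarrow> nat) \<Rightarrow> 'b::comm_monoid_add"
  assumes x: "x \<in> torusV d n" and n: "3 \<le> n"
  shows "(\<Sum>y | y \<in> torusV d n \<and> torus_adj d n x y. f y)
    = (\<Sum>i<d. f (x(i := (x i + 1) mod n)) + f (x(i := (x i + (n - 1)) mod n)))"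
proof -
  let ?g = "\<lambda>(i, s). x(i := (x i + s) mod n)"
  have xi: "x i < n" if "i < d" for i using x that by (auto simp: torusV_def)
  have "inj_on ?g ({..<d} \<times> {1, n - 1})"
  proof (rule inj_onI, clarify)
    fix i s j r
    assume i: "i < d" and j: "j < d" and s: "s \<in> {1, n - 1}" and r: "r \<in> {1, n - 1}"
      and eq: "x(i := (x i + s) mod n) = x(j := (x j + r) mod n)"
    \<comment> \<open>A step really moves its coordinate, so the direction can be read off from the
      neighbour; \<open>3 \<le> n\<close> then separates the two signs.\<close>
    have ne: "(x i + s) mod n \<noteq> x i"
      using s xi[OF i] n mod_succ[of "x i" n] mod_pred[of "x i" n] by (auto split: if_splits)
    have ij: "i = j" using fun_cong[OF eq, of i] ne by (auto split: if_splits)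
    have "(x i + s) mod n = (x i + r) mod n" using fun_cong[OF eq, of i] ij by simp
    hence "s = r"
      using s r xi[OF i] n mod_succ[of "x i" n] mod_pred[of "x i" n] by (auto split: if_splits)
    with ij show "i = j \<and> s = r" by simp
  qed
  hence "(\<Sum>y | y \<in> torusV d n \<and> torus_adj d n x y. f y) = (\<Sum>z\<in>{..<d} \<times> {1, n - 1}. f (?g z))"
    using torus_neighbours[OF x] n by (simp add: sum.reindex)
  also have "\<dots> = (\<Sum>i<d. \<Sum>s\<in>{1, n - 1}. f (?g (i, s)))"
    by (simp add: sum.cartesian_product case_prod_unfold)
  finally show ?thesis using n by simp
qed

lemma gdeg_torus:
  assumes "x \<in> torusV d n" "3 \<le> n"
  shows "gdeg (torusV d n) (torus_adj d n) x = 2 * d"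
  using sum_torus_neighbours[OF assms, of "\<lambda>_. 1 :: nat"] by (simp add: gdeg_def)

lemma finite_torusV: "finite (torusV d n)"
  by (auto simp: torusV_def intro: finite_PiE)

lemma card_torusV: "card (torusV d n) = n ^ d"
  by (simp add: torusV_def card_PiE)

text \<open>The torus is regular of degree 2d, so \<open>\<mu> k\<close> is an adjacency eigenvalue
  divided by 2d. The bound on \<open>\<mu>\<close> makes all factors, and hence the determinant,
  positive, so that the root in the zeta function is a true exponential of a logarithm.\<close>

lemma zeta_inv_torus_eq:
  fixes v :: "'k \<Rightarrow> (nat \<Rightarrow> nat) \<Rightarrow> real"
  assumes d: "1 \<le> d" and N: "2 \<le> N" and u: "0 < u" "u < 1"
    and M: "M \<subseteq> torusV d (2 * N)" and cardM: "2 * card M = (2 * N) ^ d"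
    and J: "finite J" and cardJ: "card J = card (torusV d (2 * N) - M)"
    and v0: "\<And>k x. k \<in> J \<Longrightarrow> x \<in> M \<Longrightarrow> v k x = 0"
    and eigen: "\<And>k x. k \<in> J \<Longrightarrow> x \<in> torusV d (2 * N) - M \<Longrightarrow>
       (\<Sum>y | y \<in> torusV d (2 * N) \<and> torus_adj d (2 * N) x y. v k y) = 2 * real d * \<mu> k * v k x"
    and orth: "\<And>k l. k \<in> J \<Longrightarrow> l \<in> J \<Longrightarrow> k \<noteq> l \<Longrightarrow> (\<Sum>x\<in>torusV d (2 * N). v k x * v l x) = 0"
    and norm: "\<And>k. k \<in> J \<Longrightarrow> (\<Sum>x\<in>torusV d (2 * N). v k x * v k x) \<noteq> 0"
    and \<mu>: "\<And>k. k \<in> J \<Longrightarrow> \<bar>\<mu> k\<bar> \<le> 1"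
  shows "zeta_inv_torus d N M u = exp ((2 * real d - 1/2) * ln (1 - u)
     + 1 / real ((2 * N) ^ d) * (\<Sum>k\<in>J. ln ((1 + u)\<^sup>2 - 4 * u * (\<mu> k)\<^sup>2)))"
proof -
  let ?X = "torusV d (2 * N)" and ?adj = "torus_adj d (2 * N)"
  define p where "p = (2 * N) ^ d"
  define m where "m = card M"
  have p: "0 < p" "real p = 2 * real m" "card ?X = p"
    using N cardM by (auto simp: p_def m_def card_torusV simp flip: of_nat_mult)
  define D where "D = det_on (EM ?X ?adj M) (\<lambda>e f. kd e f - u * Wsearch ?X ?adj M e f)"
  define Q where "Q = (\<Prod>k\<in>J. (1 + u)\<^sup>2 - 4 * u * (\<mu> k)\<^sup>2)"
  have deg: "gdeg ?X ?adj x = 2 * d" if "x \<in> ?X" for x using gdeg_torus that N by auto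
  have "card (EM ?X ?adj M) = 2 * d * p + m"
    using card_EM_regular[OF finite_torusV M _ deg] torus_adj_irrefl[of "2 * N"] N
    by (auto simp: p m_def)
  moreover have "(1 - u) ^ (2 * card ?X) * D = (1 - u) ^ (card (EM ?X ?adj M) + 2 * card M) * Q"
    unfolding D_def Q_def
  proof (rule det_search_walk[where v = v])
    fix k x assume k: "k \<in> J" and x: "x \<in> ?X - M"
    have "(\<Sum>y | y \<in> ?X \<and> ?adj x y. v k y / (sqrt (real (gdeg ?X ?adj x)) * sqrt (real (gdeg ?X ?adj y))))
       = (\<Sum>y | y \<in> ?X \<and> ?adj x y. v k y) / (2 * real d)"
      using x deg by (auto simp: sum_divide_distrib simp flip: real_sqrt_mult intro!: sum.cong)
    thus "(\<Sum>y | y \<in> ?X \<and> ?adj x y. v k y / (sqrt (real (gdeg ?X ?adj x)) * sqrt (real (gdeg ?X ?adj y)))) = \<mu> k * v k x"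
      using eigen[OF k x] d by simp
  next
    show "0 < gdeg ?X ?adj x" if "x \<in> ?X - M" for x using deg that d by auto
    show "\<not> ?adj x x" if "x \<in> ?X" for x using torus_adj_irrefl that N by auto
  qed (use finite_torusV M J cardJ v0 orth norm torus_adj_sym in auto)
  ultimately have eq: "(1 - u) ^ (2 * p) * D = (1 - u) ^ (2 * d * p + 3 * m) * Q"
    by (simp add: p m_def add.commute)
  have pos: "0 < (1 + u)\<^sup>2 - 4 * u * (\<mu> k)\<^sup>2" if "k \<in> J" for k
  proof -
    have "(\<mu> k)\<^sup>2 \<le> 1" using \<mu>[OF that] by (simp add: abs_square_le_1)
    hence "4 * u * (\<mu> k)\<^sup>2 \<le> 4 * u * 1" using u by (intro mult_left_mono) auto
    moreover have "(1 + u)\<^sup>2 - 4 * u * 1 = (1 - u)\<^sup>2" by (simp add: power2_eq_square algebra_simps)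
    moreover have "0 < (1 - u)\<^sup>2" using u by simp
    ultimately show ?thesis by linarith
  qed
  have Q_pos: "0 < Q" unfolding Q_def by (intro prod_pos pos)
  have ln_Q: "ln Q = (\<Sum>k\<in>J. ln ((1 + u)\<^sup>2 - 4 * u * (\<mu> k)\<^sup>2))"
    unfolding Q_def using pos by (intro ln_prod J) (metis less_irrefl)
  have u1: "0 < 1 - u" using u by simp
  have "0 < (1 - u) ^ (2 * p) * D" unfolding eq using Q_pos u1 by simp
  hence D: "0 < D" using u1 by (simp add: zero_less_mult_iff)
  have "ln ((1 - u) ^ (2 * p) * D) = ln ((1 - u) ^ (2 * d * p + 3 * m) * Q)" by (simp only: eq)
  hence "real (2 * p) * ln (1 - u) + ln D = real (2 * d * p + 3 * m) * ln (1 - u) + ln Q"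
    using u1 D Q_pos by (simp add: ln_mult ln_realpow)
  \<comment> \<open>Here \<open>m\<close> is p/2, and 2dp + 3p/2 - 2p = (2d - 1/2)p.\<close>
  hence "ln D = real p * ((2 * real d - 1/2) * ln (1 - u)) + ln Q"
    by (simp add: p algebra_simps)
  hence "1 / real p * ln D = (2 * real d - 1/2) * ln (1 - u) + 1 / real p * ln Q"
    using p(1) by (simp add: field_simps)
  moreover have "zeta_inv_torus d N M u = exp (1 / real p * ln D)"
    using D by (simp add: zeta_inv_torus_def Let_def D_def p_def powr_def)
  ultimately show ?thesis by (simp only: ln_Q p_def)
qed

section \<open>Eigenfunctions\<close>

text \<open>A step changes one coordinate, so adjacency is a sum of one-dimensional operators and
  eigenvalues add. The equations are assumed at the coordinates of the given \<open>x\<close> only,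
  because path eigenfunctions satisfy theirs only at unmarked positions.\<close>

lemma sum_torus_neighbours_prod:
  fixes \<phi> :: "nat \<Rightarrow> nat \<Rightarrow> real"
  assumes x: "x \<in> torusV d n" and n: "3 \<le> n"
    and eigen: "\<And>i. i < d \<Longrightarrow> \<phi> i ((x i + 1) mod n) + \<phi> i ((x i + (n - 1)) mod n) = \<mu> i * \<phi> i (x i)"
  shows "(\<Sum>y | y \<in> torusV d n \<and> torus_adj d n x y. \<Prod>i<d. \<phi> i (y i))
    = (\<Sum>i<d. \<mu> i) * (\<Prod>i<d. \<phi> i (x i))"
proof -
  have upd: "(\<Prod>j<d. \<phi> j ((x(i := a)) j)) = \<phi> i a * (\<Prod>j\<in>{..<d} - {i}. \<phi> j (x j))" if "i < d" for i a
  proof -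
    have "(\<Prod>j<d. \<phi> j ((x(i := a)) j)) = \<phi> i a * (\<Prod>j\<in>{..<d} - {i}. \<phi> j ((x(i := a)) j))"
      using that by (subst prod.remove[of _ i]) auto
    thus ?thesis by simp
  qed
  have "(\<Prod>j<d. \<phi> j ((x(i := (x i + 1) mod n)) j)) + (\<Prod>j<d. \<phi> j ((x(i := (x i + (n - 1)) mod n)) j))
     = \<mu> i * (\<Prod>j<d. \<phi> j (x j))" if "i < d" for i
    unfolding upd[OF that] distrib_right[symmetric] eigen[OF that]
    using that by (subst (2) prod.remove[of _ i]) auto
  thus ?thesis
    unfolding sum_torus_neighbours[OF x n] sum_distrib_right by (intro sum.cong) auto
qed

lemma sum_torusV_prod_mult:
  fixes \<phi> \<psi> :: "nat \<Rightarrow> nat \<Rightarrow> real"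
  shows "(\<Sum>x\<in>torusV d n. (\<Prod>i<d. \<phi> i (x i)) * (\<Prod>i<d. \<psi> i (x i)))
    = (\<Prod>i<d. \<Sum>a<n. \<phi> i a * \<psi> i a)"
  unfolding torusV_def by (subst prod_sum_PiE) (auto simp: prod.distrib)

section \<open>Trigonometric eigenfunctions of cycles and paths\<close>

lemma sum_cos_telescope:
  fixes a :: real
  shows "2 * sin (a / 2) * (\<Sum>j<n. cos (a * real j)) = sin (a * real n - a / 2) + sin (a / 2)"
proof (induction n)
  case (Suc n)
  have "2 * sin (a / 2) * cos (a * real n) = sin (a * real n + a / 2) - sin (a * real n - a / 2)"
    by (simp add: sin_add sin_diff)
  moreover have "a * real (Suc n) - a / 2 = a * real n + a / 2" by (simp add: algebra_simps)
  ultimately show ?case using Suc.IH by (simp add: distrib_left add.commute)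
qed simp

lemma sum_sin_telescope:
  fixes a :: real
  shows "2 * sin (a / 2) * (\<Sum>j<n. sin (a * real j)) = cos (a / 2) - cos (a * real n - a / 2)"
proof (induction n)
  case (Suc n)
  have "2 * sin (a / 2) * sin (a * real n) = cos (a * real n - a / 2) - cos (a * real n + a / 2)"
    by (simp add: cos_add cos_diff)
  moreover have "a * real (Suc n) - a / 2 = a * real n + a / 2" by (simp add: algebra_simps)
  ultimately show ?case using Suc.IH by (simp add: distrib_left add.commute)
qed simp

lemma sum_cos_root_of_unity:
  assumes "a * real n = 2 * pi * of_int m" "sin (a / 2) \<noteq> 0"
  shows "(\<Sum>j<n. cos (a * real j)) = 0"
  using sum_cos_telescope[of a n] assms by (simp add: sin_diff)

text \<open>Unlike for cosines, the degenerate frequencies need no exclusion: there every single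
  sine is zero.\<close>

lemma sum_sin_root_of_unity:
  assumes "a * real n = 2 * pi * of_int m"
  shows "(\<Sum>j<n. sin (a * real j)) = 0"
proof (cases "sin (a / 2) = 0")
  case True
  then obtain i :: int where "a / 2 = of_int i * pi" using sin_zero_iff_int2 by blast
  hence "a * real j = 2 * pi * of_int (i * int j)" for j by (simp add: field_simps)
  hence "sin (a * real j) = 0" for j by (simp only: sin_int_2pin)
  thus ?thesis by simp
next
  case False
  thus ?thesis using sum_sin_telescope[of a n] assms by (simp add: cos_diff)
qed

text \<open>The Hartley kernel: a real substitute for the characters of the cyclic group.\<close>
definition cas :: "real \<Rightarrow> real" where "cas x = cos x + sin x"

lemma cas_add_2pi_int: "cas (x + 2 * pi * of_int m) = cas x"
  by (simp add: cas_def cos_add sin_add)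

lemma cas_mult_mod:
  assumes "a * real n = 2 * pi * of_int m"
  shows "cas (a * real (j mod n)) = cas (a * real j)"
proof -
  have "real j = real n * real (j div n) + real (j mod n)"
    by (metis mult_div_mod_eq of_nat_add of_nat_mult)
  hence "a * real j = a * real (j mod n) + (a * real n) * real (j div n)"
    by (simp add: algebra_simps)
  also have "\<dots> = a * real (j mod n) + 2 * pi * of_int (m * int (j div n))"
    by (simp add: assms)
  finally show ?thesis by (simp only: cas_add_2pi_int)
qed

text \<open>Cosine and sine obey the same three-term recurrence, hence so does their sum;
  periodicity makes the wrap-around harmless.\<close>

lemma cas_eigen:
  assumes a: "a * real n = 2 * pi * of_int m" and n: "0 < n"
  shows "cas (a * real ((j + 1) mod n)) + cas (a * real ((j + (n - 1)) mod n)) = 2 * cos a * cas (a * real j)"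
proof -
  have "a * real (j + (n - 1)) = (a * real j - a) + a * real n"
    using n by (simp add: of_nat_diff algebra_simps)
  moreover note a
  moreover have "a * real (j + 1) = a * real j + a" by (simp add: algebra_simps)
  ultimately show ?thesis
    unfolding cas_mult_mod[OF a]
    by (simp only: cas_add_2pi_int) (simp add: cas_def cos_add sin_add cos_diff sin_diff algebra_simps)
qed

lemma cas_orthogonal:
  assumes a: "a * real n = 2 * pi * of_int k" and b: "b * real n = 2 * pi * of_int l"
    and ab: "sin ((a - b) / 2) \<noteq> 0"
  shows "(\<Sum>j<n. cas (a * real j) * cas (b * real j)) = 0"
proof -
  \<comment> \<open>This identity is the point of using \<open>cas\<close>: the sine part always
    sums to zero, and the cosine part does so unless the two frequencies coincide modulo
    2\<pi>.\<close>
  have "cas x * cas y = cos (x - y) + sin (x + y)" for x y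
    by (simp add: cas_def cos_diff sin_add algebra_simps)
  hence "cas (a * real j) * cas (b * real j) = cos ((a - b) * real j) + sin ((a + b) * real j)" for j
    by (simp only: left_diff_distrib distrib_right)
  moreover have "(a - b) * real n = 2 * pi * of_int (k - l)" "(a + b) * real n = 2 * pi * of_int (k + l)"
    using a b by (simp_all add: algebra_simps)
  hence "(\<Sum>j<n. cos ((a - b) * real j)) = 0" "(\<Sum>j<n. sin ((a + b) * real j)) = 0"
    using sum_cos_root_of_unity[OF _ ab] sum_sin_root_of_unity by blast+
  ultimately show ?thesis by (simp add: sum.distrib)
qed

text \<open>Discrete Green formula: the right-hand side is the Casoratian (discrete Wronskian) of
  two solutions of the second-order recurrence, and its increments are the summands. Orthogonality
  then depends on boundary values alone.\<close>

lemma sum_sin_mult_sin: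
  fixes a b :: real
  shows "(2 * cos a - 2 * cos b) * (\<Sum>s<Suc m. sin (a * real s) * sin (b * real s))
    = sin (a * real (Suc m)) * sin (b * real m) - sin (a * real m) * sin (b * real (Suc m))"
proof (induction m)
  case (Suc m)
  let ?x = "a * real (Suc m)" and ?y = "b * real (Suc m)"
  have e: "a * real (Suc (Suc m)) = ?x + a" "b * real (Suc (Suc m)) = ?y + b"
    "a * real m = ?x - a" "b * real m = ?y - b"
    by (simp_all add: algebra_simps)
  have "(2 * cos a - 2 * cos b) * (\<Sum>s<Suc (Suc m). sin (a * real s) * sin (b * real s))
    = sin ?x * sin (?y - b) - sin (?x - a) * sin ?y + (2 * cos a - 2 * cos b) * (sin ?x * sin ?y)"
    using Suc.IH unfolding sum.lessThan_Suc[of _ "Suc m"] distrib_left e(3,4) by simp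
  also have "sin x * sin (y - b) - sin (x - a) * sin y + (2 * cos a - 2 * cos b) * (sin x * sin y)
      = sin (x + a) * sin y - sin x * sin (y + b)" for x y
    by (simp add: sin_add sin_diff algebra_simps)
  finally show ?case unfolding e .
qed simp

text \<open>Dirichlet eigenfunctions of the path \<open>{N..<2N}\<close>, extended by zero; the sine itself vanishes
  at both neighbours \<open>N - 1\<close> and \<open>2N\<close> of the path.\<close>
definition pathfun :: "nat \<Rightarrow> real \<Rightarrow> nat \<Rightarrow> real" where
  "pathfun N b j = (if j < N then 0 else sin (b * (real j - real N + 1)))"

text \<open>The condition on \<open>b\<close> is the boundary condition at the far end: the
  successor of 2N - 1 wraps round to the marked position 0, and the sine at
  \<open>b * real (N + 1)\<close> has to vanish as well. At the near end, \<open>j = N\<close>, the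
  sine vanishes for any \<open>b\<close>.\<close>

lemma pathfun_eigen:
  assumes b: "b * real (N + 1) = pi * real k" and j: "N \<le> j" "j < 2 * N"
  shows "pathfun N b ((j + 1) mod (2 * N)) + pathfun N b ((j + (2 * N - 1)) mod (2 * N))
     = 2 * cos b * pathfun N b j"
proof -
  let ?s = "b * (real j - real N + 1)"
  have "pathfun N b ((j + 1) mod (2 * N)) = sin (?s + b)"
  proof (cases "j + 1 = 2 * N")
    case True
    hence "real j = 2 * real N - 1" by (simp add: algebra_simps flip: of_nat_Suc of_nat_mult)
    hence "?s + b = b * real (N + 1)" by (simp add: algebra_simps)
    hence "sin (?s + b) = 0" unfolding b by simp
    thus ?thesis using True j by (simp add: pathfun_def)
  next
    case False
    thus ?thesis using j mod_succ[of j "2 * N"] by (simp add: pathfun_def algebra_simps)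
  qed
  moreover have "pathfun N b ((j + (2 * N - 1)) mod (2 * N)) = sin (?s - b)"
  proof (cases "j = N")
    case True
    thus ?thesis using j mod_pred[of j "2 * N"] by (simp add: pathfun_def)
  next
    case False
    thus ?thesis using j mod_pred[of j "2 * N"]
      by (auto simp: pathfun_def algebra_simps of_nat_diff)
  qed
  moreover have "pathfun N b j = sin ?s" using j by (simp add: pathfun_def)
  moreover have "sin (s + b) + sin (s - b) = 2 * cos b * sin s" for s
    by (simp add: sin_add sin_diff)
  ultimately show ?thesis by (simp only:)
qed

lemma sum_pathfun_mult:
  "(\<Sum>j<2 * N. pathfun N a j * pathfun N b j) = (\<Sum>s<Suc N. sin (a * real s) * sin (b * real s))"
proof -
  have "(\<Sum>j<2 * N. pathfun N a j * pathfun N b j) = (\<Sum>j\<in>{N..<2 * N}. pathfun N a j * pathfun N b j)"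
    by (intro sum.mono_neutral_right) (auto simp: pathfun_def)
  also have "\<dots> = (\<Sum>s<N. pathfun N a (s + N) * pathfun N b (s + N))"
    using sum.shift_bounds_nat_ivl[of "\<lambda>j. pathfun N a j * pathfun N b j" 0 N N]
    by (simp add: mult_2 atLeast0LessThan)
  also have "\<dots> = (\<Sum>s<N. sin (a * real (Suc s)) * sin (b * real (Suc s)))"
    by (simp add: pathfun_def add.commute)
  \<comment> \<open>The added term at \<open>s = 0\<close> is zero; it brings the sum into the form
    of the Green formula.\<close>
  finally show ?thesis by (subst sum.lessThan_Suc_shift) simp
qed

text \<open>Both sines vanish at N + 1, so the boundary term of the Green formula is zero and the
  distinct eigenvalues can be divided out.\<close>

lemma pathfun_orthogonal:
  assumes "a * real (N + 1) = pi * real k" "b * real (N + 1) = pi * real l" "cos a \<noteq> cos b"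
  shows "(\<Sum>j<2 * N. pathfun N a j * pathfun N b j) = 0"
proof -
  have "sin (a * real (Suc N)) = 0" "sin (b * real (Suc N)) = 0"
    using assms(1,2) by simp_all
  hence "(2 * cos a - 2 * cos b) * (\<Sum>j<2 * N. pathfun N a j * pathfun N b j) = 0"
    unfolding sum_pathfun_mult sum_sin_mult_sin by simp
  thus ?thesis using assms(3) by simp
qed

section \<open>Riemann sums on the torus\<close>

lemma prob_space_uniform_circle: "prob_space (uniform_measure lborel {0..<2*pi})"
  by (rule prob_space_uniform_measure) auto

lemma measure_uniform_circle:
  assumes "0 \<le> a" "a \<le> b" "b \<le> 2 * pi"
  shows "measure (uniform_measure lborel {0..<2*pi}) {a..<b} = (b - a) / (2 * pi)"
proof -
  have "{0..<2*pi} \<inter> {a..<b} = {a..<b}" using assms by auto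
  thus ?thesis using assms by (subst measure_uniform_measure) auto
qed

lemma mem_cell_iff:
  fixes t :: real
  assumes "0 < n"
  shows "t \<in> {2 * pi * (real k - 1) / real n ..< 2 * pi * real k / real n} \<longleftrightarrow> \<lfloor>real n * t / (2 * pi)\<rfloor> + 1 = int k"
proof -
  have "t \<in> {2 * pi * (real k - 1) / real n ..< 2 * pi * real k / real n} \<longleftrightarrow>
     real_of_int (int k - 1) \<le> real n * t / (2 * pi) \<and> real n * t / (2 * pi) < real_of_int (int k - 1) + 1"
    using assms by (auto simp: field_simps)
  also have "\<dots> \<longleftrightarrow> \<lfloor>real n * t / (2 * pi)\<rfloor> = int k - 1"
    by (simp add: floor_eq_iff)
  finally show ?thesis by linarith
qed

text \<open>Both sides are integrals: the left one of the step function that takes the value at the node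
  of each cell, so that dominated convergence applies.\<close>
lemma Riemann_sums_uniform_circle_tendsto:
  fixes F :: "('i \<Rightarrow> real) \<Rightarrow> real" and n :: "'i \<Rightarrow> nat \<Rightarrow> nat" and t :: "'i \<Rightarrow> nat \<Rightarrow> nat \<Rightarrow> real"
  assumes I: "finite I"
    and n: "\<And>i. i \<in> I \<Longrightarrow> filterlim (n i) at_top sequentially"
    and t: "\<And>i N k. i \<in> I \<Longrightarrow> k \<in> {1..n i N} \<Longrightarrow>
      t i N k \<in> {2 * pi * (real k - 1) / real (n i N) .. 2 * pi * real k / real (n i N)}"
    and cont: "\<And>X \<theta>. (\<And>i. i \<in> I \<Longrightarrow> (\<lambda>N. X N i) \<longlonglongrightarrow> \<theta> i) \<Longrightarrow> (\<lambda>N. F (X N)) \<longlonglongrightarrow> F \<theta>"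
    and bound: "\<And>\<theta>. \<bar>F \<theta>\<bar> \<le> B"
    and meas: "F \<in> borel_measurable (PiM I (\<lambda>_. uniform_measure lborel {0..<2*pi}))"
  shows "(\<lambda>N. (\<Sum>k\<in>PiE I (\<lambda>i. {1..n i N}). F (\<lambda>i. t i N (k i))) / (\<Prod>i\<in>I. real (n i N)))
    \<longlonglongrightarrow> (LINT \<theta>|PiM I (\<lambda>_. uniform_measure lborel {0..<2*pi}). F \<theta>)"
proof -
  let ?U = "uniform_measure lborel {0..<2*pi}"
  let ?P = "PiM I (\<lambda>_. ?U)"
  interpret U: prob_space ?U by (rule prob_space_uniform_circle)
  interpret P: product_prob_space "\<lambda>_. ?U" I ..
  interpret PS: prob_space ?P by (rule prob_space_PiM) (rule prob_space_uniform_circle)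
  define cell where "cell i N k = {2 * pi * (real k - 1) / real (n i N) ..< 2 * pi * real k / real (n i N)}" for i N k
  define K where "K N = PiE I (\<lambda>i. {1..n i N})" for N
  \<comment> \<open>The product of indicators singles out a box. The boxes partition the cube, and
    each has mass one over the product of the \<open>n i N\<close>, so integrating
    \<open>S N\<close> gives the Riemann sum.\<close>
  define S where "S N \<theta> = (\<Sum>k\<in>K N. F (\<lambda>i. t i N (k i)) * (\<Prod>i\<in>I. indicator (cell i N (k i)) (\<theta> i)))"
    for N and \<theta> :: "'i \<Rightarrow> real"
  have finK: "finite (K N)" for N unfolding K_def using I by (intro finite_PiE) auto
  have [measurable]: "(\<lambda>x. indicator (cell i N k) x :: real) \<in> borel_measurable ?U" for i N k
    unfolding cell_def by measurable
  have int_ind: "integrable ?U (\<lambda>x. indicator (cell i N k) x :: real)" for i N k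
  proof (rule U.integrable_const_bound[where B = 1])
    show "AE x in ?U. norm (indicator (cell i N k) x :: real) \<le> 1" by (auto simp: indicator_def)
  qed measurable
  have mcell: "(LINT x|?U. indicator (cell i N k) x) = 1 / real (n i N)"
    if "i \<in> I" "k \<in> {1..n i N}" for i N k
  proof -
    have "(LINT x|?U. indicator (cell i N k) x) = measure ?U (cell i N k)" by simp
    also have "\<dots> = 1 / real (n i N)"
      unfolding cell_def using that
      by (subst measure_uniform_circle) (auto simp: field_simps)
    finally show ?thesis .
  qed
  have int_term: "integrable ?P (\<lambda>\<theta>. \<Prod>i\<in>I. indicator (cell i N (k i)) (\<theta> i) :: real)" for N k
    by (rule P.product_integrable_prod[OF I int_ind])
  have int_S: "(LINT \<theta>|?P. S N \<theta>) = (\<Sum>k\<in>K N. F (\<lambda>i. t i N (k i))) / (\<Prod>i\<in>I. real (n i N))" for N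
  proof -
    have "(LINT \<theta>|?P. S N \<theta>) = (\<Sum>k\<in>K N. LINT \<theta>|?P. F (\<lambda>i. t i N (k i)) * (\<Prod>i\<in>I. indicator (cell i N (k i)) (\<theta> i)))"
      unfolding S_def using int_term by (intro Bochner_Integration.integral_sum) auto
    also have "\<dots> = (\<Sum>k\<in>K N. F (\<lambda>i. t i N (k i)) * (\<Prod>i\<in>I. LINT x|?U. indicator (cell i N (k i)) x))"
      using int_term by (simp add: P.product_integral_prod[OF I int_ind])
    also have "\<dots> = (\<Sum>k\<in>K N. F (\<lambda>i. t i N (k i)) / (\<Prod>i\<in>I. real (n i N)))"
    proof (intro sum.cong refl)
      fix k assume "k \<in> K N"
      hence "(\<Prod>i\<in>I. LINT x|?U. indicator (cell i N (k i)) x) = (\<Prod>i\<in>I. 1 / real (n i N))"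
        by (intro prod.cong refl mcell) (auto simp: K_def)
      thus "F (\<lambda>i. t i N (k i)) * (\<Prod>i\<in>I. LINT x|?U. indicator (cell i N (k i)) x)
          = F (\<lambda>i. t i N (k i)) / (\<Prod>i\<in>I. real (n i N))"
        by (simp add: prod_dividef)
    qed
    finally show ?thesis by (simp add: sum_divide_distrib)
  qed
  \<comment> \<open>The number, counted from 1, of the cell that contains \<open>x\<close>.\<close>
  define q where "q i N x = nat (\<lfloor>real (n i N) * x / (2 * pi)\<rfloor> + 1)" for i N and x :: real
  have q: "q i N x \<in> {1..n i N}" and cell_q: "x \<in> cell i N k \<longleftrightarrow> k = q i N x"
    if "x \<in> {0..<2*pi}" "0 < n i N" for i N x k
  proof -
    let ?f = "\<lfloor>real (n i N) * x / (2 * pi)\<rfloor>"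
    have "0 \<le> ?f" using that by auto
    moreover have "?f < int (n i N)"
      using that by (auto simp: floor_less_iff field_simps)
    moreover have "nat (z + 1) \<in> {1..m}" "z + 1 = int k \<longleftrightarrow> k = nat (z + 1)"
      if "0 \<le> z" "z < int m" for z m
      using that by auto
    ultimately show "q i N x \<in> {1..n i N}" "x \<in> cell i N k \<longleftrightarrow> k = q i N x"
      unfolding cell_def mem_cell_iff[OF that(2)] q_def by blast+
  qed
  have S_eq: "S N \<theta> = F (\<lambda>i. t i N (restrict (\<lambda>i. q i N (\<theta> i)) I i))"
    if \<theta>: "\<And>i. i \<in> I \<Longrightarrow> \<theta> i \<in> {0..<2*pi}" and pos: "\<And>i. i \<in> I \<Longrightarrow> 0 < n i N" for N \<theta>
  proof -
    let ?k = "restrict (\<lambda>i. q i N (\<theta> i)) I"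
    have k: "?k \<in> K N" using q \<theta> pos by (auto simp: K_def)
    have ind: "(\<Prod>i\<in>I. indicator (cell i N (k i)) (\<theta> i) :: real) = (if k = ?k then 1 else 0)" if "k \<in> K N" for k
    proof (cases "k = ?k")
      case True
      have "(\<Prod>i\<in>I. indicator (cell i N (k i)) (\<theta> i) :: real) = 1"
        using True \<theta> pos cell_q by (intro prod.neutral) auto
      thus ?thesis using True by simp
    next
      case False
      have "\<exists>i\<in>I. k i \<noteq> ?k i"
      proof (rule ccontr)
        assume "\<not> (\<exists>i\<in>I. k i \<noteq> ?k i)"
        hence "k = ?k" using that k unfolding K_def by (intro PiE_ext) blast+
        thus False using False by contradiction
      qed
      then obtain i where "i \<in> I" "k i \<noteq> ?k i" by blast
      hence "indicator (cell i N (k i)) (\<theta> i) = (0 :: real)"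
        using \<theta> pos cell_q by auto
      thus ?thesis using False \<open>i \<in> I\<close> I by (auto simp: prod_zero_iff)
    qed
    have "S N \<theta> = (\<Sum>k\<in>K N. if k = ?k then F (\<lambda>i. t i N (?k i)) else 0)"
      unfolding S_def by (intro sum.cong refl) (auto simp: ind)
    thus ?thesis using k finK by simp
  qed
  have ev_pos: "\<forall>\<^sub>F N in sequentially. \<forall>i\<in>I. 0 < n i N"
    using eventually_compose_filterlim[OF eventually_gt_at_top n] by (intro eventually_ball_finite I) blast
  have conv: "(\<lambda>N. S N \<theta>) \<longlonglongrightarrow> F \<theta>" if \<theta>: "\<forall>i\<in>I. \<theta> i \<in> {0..<2*pi}" for \<theta>
  proof -
    let ?X = "\<lambda>N i. t i N (restrict (\<lambda>i. q i N (\<theta> i)) I i)"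
    have "(\<lambda>N. F (?X N)) \<longlonglongrightarrow> F \<theta>"
    \<comment> \<open>\<open>cont\<close> is sequential continuity in the coordinates from
      \<open>I\<close>; values elsewhere are irrelevant. The node and the point share a cell, so
      their distance is at most the cell length 2\<pi>/n.\<close>
    proof (rule cont)
      fix i assume i: "i \<in> I"
      have "\<forall>\<^sub>F N in sequentially. norm (?X N i - \<theta> i) \<le> 2 * pi / real (n i N)"
        using ev_pos
      proof eventually_elim
        case (elim N)
        have "q i N (\<theta> i) \<in> {1..n i N}" "\<theta> i \<in> cell i N (q i N (\<theta> i))"
          using q cell_q elim \<theta> i by auto
        with t[OF i this(1)] i show ?case
          by (auto simp: cell_def abs_le_iff diff_divide_distrib right_diff_distrib)
      qed
      moreover have "(\<lambda>N. 2 * pi / real (n i N)) \<longlonglongrightarrow> 0"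
        using filterlim_compose[OF filterlim_real_sequentially n[OF i]]
        by (rule real_tendsto_divide_at_top[OF tendsto_const])
      ultimately have "(\<lambda>N. ?X N i - \<theta> i) \<longlonglongrightarrow> 0"
        by (rule Lim_null_comparison)
      thus "(\<lambda>N. ?X N i) \<longlonglongrightarrow> \<theta> i" by (simp add: LIM_zero_iff)
    qed
    moreover have "\<forall>\<^sub>F N in sequentially. F (?X N) = S N \<theta>"
      using ev_pos by eventually_elim (use S_eq \<theta> in auto)
    ultimately show ?thesis by (rule Lim_transform_eventually)
  qed
  have AE_box: "AE \<theta> in ?P. \<forall>i\<in>I. \<theta> i \<in> {0..<2*pi}"
  proof (rule AE_finite_allI[OF I])
    fix i assume "i \<in> I"
    moreover have "AE x in ?U. x \<in> {0..<2*pi}" by (rule AE_uniform_measureI) auto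
    ultimately show "AE \<theta> in ?P. \<theta> i \<in> {0..<2*pi}"
      by (intro AE_PiM_component[where P = "\<lambda>x. x \<in> {0..<2*pi}"] prob_space_uniform_circle)
  qed
  \<comment> \<open>When some \<open>n i N\<close> is 0 there are no cells and \<open>S N\<close> is
    an empty sum; the dominating constant must cover this value too.\<close>
  have B0: "0 \<le> B" using bound[of undefined] by linarith
  have "(\<lambda>N. LINT \<theta>|?P. S N \<theta>) \<longlonglongrightarrow> (LINT \<theta>|?P. F \<theta>)"
  proof (rule integral_dominated_convergence[where w = "\<lambda>_. B"])
    show "F \<in> borel_measurable ?P" by (fact meas)
    show "S N \<in> borel_measurable ?P" for N
      unfolding S_def using borel_measurable_integrable[OF int_term]
      by (intro borel_measurable_sum borel_measurable_times borel_measurable_const)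
    show "AE \<theta> in ?P. (\<lambda>N. S N \<theta>) \<longlonglongrightarrow> F \<theta>"
      using AE_box by eventually_elim (rule conv)
    show "AE \<theta> in ?P. norm (S N \<theta>) \<le> B" for N
      using AE_box
    proof eventually_elim
      case (elim \<theta>)
      show ?case
      proof (cases "\<forall>i\<in>I. 0 < n i N")
        case True
        thus ?thesis using S_eq[of \<theta> N] elim bound by auto
      next
        case False
        then obtain i where "i \<in> I" "n i N = 0" by auto
        hence "K N = {}" by (auto simp: K_def PiE_eq_empty_iff)
        thus ?thesis using B0 by (simp add: S_def)
      qed
    qed
  qed simp
  thus ?thesis unfolding int_S K_def .
qed

section \<open>The two marked sets\<close>

lemma torus_adj_parity:
  assumes x: "x \<in> torusV d n" and y: "y \<in> torusV d n" and adj: "torus_adj d n x y" and n: "even n" "0 < n"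
  shows "even (\<Sum>i<d. y i) \<longleftrightarrow> odd (\<Sum>i<d. x i)"
proof -
  have "y \<in> (\<lambda>(i, s). x(i := (x i + s) mod n)) ` ({..<d} \<times> {1, n - 1})"
    using torus_neighbours[OF x n(2)] y adj by blast
  then obtain i s where i: "i < d" and s: "s \<in> {1, n - 1}" and y_eq: "y = x(i := (x i + s) mod n)"
    by auto
  \<comment> \<open>Both steps, 1 and n - 1, are odd, and reduction modulo an even number keeps
    parity: the torus is bipartite.\<close>
  have "odd s" using s n by auto
  moreover have "even ((x i + s) mod n) \<longleftrightarrow> even (x i + s)" using n by (simp add: dvd_mod_iff)
  moreover have "(\<Sum>j<d. y j) = (x i + s) mod n + (\<Sum>j\<in>{..<d} - {i}. x j)"
    using i by (subst sum.remove[of _ i]) (auto simp: y_eq)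
  moreover have "(\<Sum>j<d. x j) = x i + (\<Sum>j\<in>{..<d} - {i}. x j)"
    using i by (subst sum.remove[of _ i]) auto
  ultimately show ?thesis by auto
qed

text \<open>Translation by one in coordinate 0 is injective and exchanges the two parity classes,
  which bounds each cardinality by the other.\<close>

lemma card_Mcase1:
  assumes d: "1 \<le> d" and N: "1 \<le> N"
  shows "card (torusV d (2 * N) - Mcase1 d N) = card (Mcase1 d N)"
proof -
  let ?X = "torusV d (2 * N)" and ?M = "Mcase1 d N"
  define f where "f x = x(0 := (x 0 + 1) mod (2 * N))" for x :: "nat \<Rightarrow> nat"
  have fin: "finite ?M" "finite (?X - ?M)" using finite_torusV[of d "2 * N"] by (auto simp: Mcase1_def)
  have fX: "f x \<in> ?X" if "x \<in> ?X" for x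
    using that d N by (auto simp: f_def torusV_def PiE_def extensional_def)
  have adj: "torus_adj d (2 * N) x (f x)" for x
    using d by (auto simp: torus_adj_def f_def intro!: exI[of _ 0])
  have parity: "even (\<Sum>i<d. f x i) \<longleftrightarrow> odd (\<Sum>i<d. x i)" if "x \<in> ?X" for x
    using N by (intro torus_adj_parity[OF that fX[OF that] adj]) auto
  have inj: "inj_on f ?X"
  proof (rule inj_onI)
    fix x y assume x: "x \<in> ?X" and y: "y \<in> ?X" and eq: "f x = f y"
    have "x 0 < 2 * N" "y 0 < 2 * N" using x y d torusV_less by simp_all
    moreover have "(x 0 + 1) mod (2 * N) = (y 0 + 1) mod (2 * N)"
      using fun_cong[OF eq, of 0] by (simp add: f_def)
    ultimately have "x 0 = y 0"
      using mod_succ[of "x 0" "2 * N"] mod_succ[of "y 0" "2 * N"] by (auto split: if_splits)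
    moreover have "x j = y j" if "j \<noteq> 0" for j using fun_cong[OF eq, of j] that by (simp add: f_def)
    ultimately show "x = y" by (metis ext)
  qed
  have "card (?X - ?M) \<le> card ?M"
    using inj fX parity fin by (intro card_inj_on_le[of f]) (auto simp: Mcase1_def intro: inj_on_subset)
  moreover have "card ?M \<le> card (?X - ?M)"
    using inj fX parity fin by (intro card_inj_on_le[of f]) (auto simp: Mcase1_def intro: inj_on_subset)
  ultimately show ?thesis by simp
qed

lemma zeta_inv_torus_Mcase1:
  assumes d: "1 \<le> d" and N: "2 \<le> N" and u: "0 < u" "u < 1"
  shows "zeta_inv_torus d N (Mcase1 d N) u = exp ((2 * real d - 1/2) * ln (1 - u) + ln (1 + u))"
proof -
  let ?X = "torusV d (2 * N)" and ?M = "Mcase1 d N"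
  have sub: "?M \<subseteq> ?X" by (auto simp: Mcase1_def)
  have "card (?X - ?M) = card ?X - card ?M" "card ?M \<le> card ?X"
    using sub finite_torusV by (auto intro!: card_Diff_subset card_mono intro: finite_subset)
  hence card: "2 * card ?M = (2 * N) ^ d"
    using card_Mcase1[OF d, of N] N by (simp add: card_torusV)
  have "zeta_inv_torus d N ?M u = exp ((2 * real d - 1/2) * ln (1 - u)
     + 1 / real ((2 * N) ^ d) * (\<Sum>k\<in>?X - ?M. ln ((1 + u)\<^sup>2 - 4 * u * 0\<^sup>2)))"
  \<comment> \<open>All neighbours of an odd vertex are even, hence marked. The killed walk is the
    zero operator, and point masses serve as eigenfunctions.\<close>
  proof (rule zeta_inv_torus_eq[OF d N u sub card, where v = kd and \<mu> = "\<lambda>_. 0"])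
    fix k x assume k: "k \<in> ?X - ?M" and x: "x \<in> ?X - ?M"
    have "kd k y = 0" if "y \<in> ?X" "torus_adj d (2 * N) x y" for y
      using torus_adj_parity[of x d "2 * N" y] that k x N by (auto simp: kd_def Mcase1_def)
    thus "(\<Sum>y | y \<in> ?X \<and> torus_adj d (2 * N) x y. kd k y) = 2 * real d * 0 * kd k x"
      by (auto intro: sum.neutral)
  next
    fix k assume k: "k \<in> ?X - ?M"
    have "(\<Sum>x\<in>?X. kd k x * kd k x) = (\<Sum>x\<in>?X. if k = x then 1 else 0)"
      by (intro sum.cong) (auto simp: kd_def)
    thus "(\<Sum>x\<in>?X. kd k x * kd k x) \<noteq> 0" using k finite_torusV by simp
  next
    show "(\<Sum>x\<in>?X. kd k x * kd l x) = 0" if "k \<noteq> l" for k l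
      using that by (intro sum.neutral) (auto simp: kd_def)
  qed (use finite_torusV in \<open>auto simp: kd_def\<close>)
  \<comment> \<open>Half of the vertices contribute 2 ln(1 + u) each, so the normalised coefficient
    is 1.\<close>
  also have "(\<Sum>k\<in>?X - ?M. ln ((1 + u)\<^sup>2 - 4 * u * 0\<^sup>2)) = real ((2 * N) ^ d) * ln (1 + u)"
  proof -
    have "real ((2 * N) ^ d) = 2 * real (card ?M)" by (simp only: of_nat_mult of_nat_numeral flip: card)
    thus ?thesis using u card_Mcase1[OF d, of N] N by (simp add: ln_realpow)
  qed
  finally show ?thesis using N by simp
qed

section \<open>Case 2: one half of the torus is marked\<close>

lemma prod_lessThan_last:
  fixes a b :: "'b::comm_semiring_1"
  assumes "1 \<le> (d::nat)"
  shows "(\<Prod>i<d. if i = d - 1 then a else b) = a * b ^ (d - 1)"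
proof -
  obtain e where d: "d = Suc e" using assms by (cases d) auto
  have "(\<Prod>i<e. if i = e then a else b) = (\<Prod>i<e. b)" by (intro prod.cong) auto
  thus ?thesis unfolding d by (simp add: mult.commute)
qed

lemma abs_sum_cos_le:
  assumes "1 \<le> (d::nat)"
  shows "\<bar>(\<Sum>i<d - 1. cos (f i)) + cos (c::real)\<bar> \<le> real d"
proof -
  have "\<bar>\<Sum>i<d - 1. cos (f i :: real)\<bar> \<le> (\<Sum>i<d - 1. 1)"
    by (intro order_trans[OF sum_abs] sum_mono) auto
  hence "\<bar>\<Sum>i<d - 1. cos (f i)\<bar> \<le> real d - 1" using assms by (simp add: of_nat_diff)
  moreover have "\<bar>cos c\<bar> \<le> 1" by simp
  ultimately show ?thesis by linarith
qed

lemma card_Mcase2: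
  assumes d: "1 \<le> d" and N: "1 \<le> N"
  shows "card (torusV d (2 * N) - Mcase2 d N) = N * (2 * N) ^ (d - 1)"
proof -
  have "torusV d (2 * N) - Mcase2 d N = PiE {..<d} (\<lambda>i. if i = d - 1 then {N..<2 * N} else {..<2 * N})"
  proof (intro equalityI subsetI)
    fix x assume "x \<in> torusV d (2 * N) - Mcase2 d N"
    thus "x \<in> PiE {..<d} (\<lambda>i. if i = d - 1 then {N..<2 * N} else {..<2 * N})"
      using N by (auto simp: torusV_def Mcase2_def PiE_iff)
  next
    fix x assume x: "x \<in> PiE {..<d} (\<lambda>i. if i = d - 1 then {N..<2 * N} else {..<2 * N})"
    have "x i < 2 * N" if "i < d" for i using PiE_mem[OF x, of i] that by (auto split: if_splits)
    moreover have "N \<le> x (d - 1)" using PiE_mem[OF x, of "d - 1"] d by auto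
    ultimately show "x \<in> torusV d (2 * N) - Mcase2 d N"
      using x N by (auto simp: torusV_def Mcase2_def PiE_iff)
  qed
  hence "card (torusV d (2 * N) - Mcase2 d N) = (\<Prod>i<d. card (if i = d - 1 then {N..<2 * N} else {..<2 * N}))"
    by (simp only: card_PiE finite_lessThan)
  also have "\<dots> = (\<Prod>i<d. if i = d - 1 then N else 2 * N)" by (intro prod.cong) auto
  finally show ?thesis by (simp only: prod_lessThan_last[OF d])
qed

lemma zeta_inv_torus_Mcase2:
  assumes d: "1 \<le> d" and N: "2 \<le> N" and u: "0 < u" "u < 1"
  shows "zeta_inv_torus d N (Mcase2 d N) u
    = exp ((2 * real d - 1/2) * ln (1 - u)
        + 1 / real ((2*N)^d) *
          (\<Sum>k\<in>PiE {..<d} (\<lambda>i. if i = d - 1 then {1..N} else {1..2*N}).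
             ln ((1 + u)^2 - 4 * u / (real d)^2 *
               ((\<Sum>i<d-1. cos ((real (k i) - 1) * pi / real N))
                + cos (real (k (d-1)) * pi / real (N + 1)))^2)))"
proof -
  let ?X = "torusV d (2 * N)" and ?M = "Mcase2 d N"
  define J where "J = PiE {..<d} (\<lambda>i. if i = d - 1 then {1..N} else {1..2*N})"
  define a where "a k = (real k - 1) * pi / real N" for k :: nat
  define b where "b k = real k * pi / real (N + 1)" for k :: nat
  have a: "a k * real (2 * N) = 2 * pi * of_int (int k - 1)" for k
    using N by (simp add: a_def)
  have b: "b k * real (N + 1) = pi * real k" for k
    by (simp add: b_def)
  \<comment> \<open>On (0, \<pi>) the cosine is injective, which separates the path eigenvalues, and
    the sine is positive, which keeps the eigenfunctions nonzero.\<close>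
  have b_range: "0 < b k" "b k < pi" if "k \<in> {1..N}" for k
  proof -
    have "real k * pi < real (N + 1) * pi" using that by (intro mult_strict_right_mono) auto
    thus "b k < pi" unfolding b_def by (simp add: pos_divide_less_eq mult.commute)
    show "0 < b k" using that by (simp add: b_def)
  qed
  define \<phi> where "\<phi> i k j = (if i = d - 1 then pathfun N (b k) j else cas (a k * real j))" for i k j
  define v where "v k x = (\<Prod>i<d. \<phi> i (k i) (x i))" for k x :: "nat \<Rightarrow> nat"
  define \<mu> where "\<mu> k = ((\<Sum>i<d - 1. cos (a (k i))) + cos (b (k (d - 1)))) / real d" for k :: "nat \<Rightarrow> nat"
  have N1: "1 \<le> N" using N by simp
  have pd: "(2 * N) ^ d = 2 * (N * (2 * N) ^ (d - 1))"
    using d by (cases d) simp_all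
  have cardJ: "card J = card (?X - ?M)"
  proof -
    have "card J = (\<Prod>i<d. card (if i = d - 1 then {1..N} else {1..2*N}))"
      unfolding J_def by (simp only: card_PiE finite_lessThan)
    also have "\<dots> = (\<Prod>i<d. if i = d - 1 then N else 2 * N)" by (intro prod.cong) auto
    finally show ?thesis using card_Mcase2[OF d N1] by (simp only: prod_lessThan_last[OF d])
  qed
  have sub: "?M \<subseteq> ?X" by (auto simp: Mcase2_def)
  have "card (?X - ?M) = card ?X - card ?M" "card ?M \<le> card ?X"
    using sub finite_torusV by (auto intro!: card_Diff_subset card_mono intro: finite_subset)
  hence card: "2 * card ?M = (2 * N) ^ d"
    using card_Mcase2[OF d N1] unfolding card_torusV pd by linarith
  have Jk: "k i \<in> (if i = d - 1 then {1..N} else {1..2*N})" if "k \<in> J" "i < d" for k i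
    using PiE_mem[OF that(1)[unfolded J_def], of i] that(2) by simp
  have "zeta_inv_torus d N ?M u = exp ((2 * real d - 1/2) * ln (1 - u)
     + 1 / real ((2 * N) ^ d) * (\<Sum>k\<in>J. ln ((1 + u)\<^sup>2 - 4 * u * (\<mu> k)\<^sup>2)))"
  proof (rule zeta_inv_torus_eq[OF d N u sub card _ cardJ, where v = v])
    show "finite J" unfolding J_def by (intro finite_PiE) auto
    show "v k x = 0" if "k \<in> J" "x \<in> ?M" for k x
    proof -
      have "\<phi> (d - 1) (k (d - 1)) (x (d - 1)) = 0"
        using that N by (auto simp: Mcase2_def \<phi>_def pathfun_def)
      thus ?thesis unfolding v_def using d by (intro prod_zero) (auto intro!: bexI[of _ "d - 1"])
    qed
    show "(\<Sum>y | y \<in> ?X \<and> torus_adj d (2 * N) x y. v k y) = 2 * real d * \<mu> k * v k x"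
      if k: "k \<in> J" and x: "x \<in> ?X - ?M" for k x
    proof -
      \<comment> \<open>The path equation holds only on unmarked positions; this is where
        \<open>x \<notin> ?M\<close> enters.\<close>
      have last: "N \<le> x (d - 1)" "x (d - 1) < 2 * N"
        using x d N torusV_less[of x d "2 * N" "d - 1"] by (auto simp: Mcase2_def)
      have "(\<Sum>y | y \<in> ?X \<and> torus_adj d (2 * N) x y. v k y)
          = (\<Sum>i<d. if i = d - 1 then 2 * cos (b (k i)) else 2 * cos (a (k i))) * v k x"
        unfolding v_def
      proof (rule sum_torus_neighbours_prod)
        fix i assume "i < d"
        show "\<phi> i (k i) ((x i + 1) mod (2 * N)) + \<phi> i (k i) ((x i + (2 * N - 1)) mod (2 * N))
          = (if i = d - 1 then 2 * cos (b (k i)) else 2 * cos (a (k i))) * \<phi> i (k i) (x i)"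
          using pathfun_eigen[OF b last] cas_eigen[OF a] N by (simp add: \<phi>_def)
      qed (use x N in auto)
      also have "(\<Sum>i<d. if i = d - 1 then 2 * cos (b (k i)) else 2 * cos (a (k i))) = 2 * real d * \<mu> k"
      proof -
        obtain e where e: "d = Suc e" using d by (cases d) auto
        have "2 * real d * \<mu> k = 2 * ((\<Sum>i<d - 1. cos (a (k i))) + cos (b (k (d - 1))))"
          using d by (simp add: \<mu>_def)
        thus ?thesis unfolding e by (simp add: sum_distrib_left)
      qed
      finally show ?thesis .
    qed
    have gram: "(\<Sum>x\<in>?X. v k x * v l x) = (\<Prod>i<d. \<Sum>j<2 * N. \<phi> i (k i) j * \<phi> i (l i) j)" for k l
      unfolding v_def by (rule sum_torusV_prod_mult)
    show "(\<Sum>x\<in>?X. v k x * v l x) = 0" if k: "k \<in> J" and l: "l \<in> J" and "k \<noteq> l" for k l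
    proof -
      have "\<exists>i<d. k i \<noteq> l i"
      proof (rule ccontr)
        assume "\<not> (\<exists>i<d. k i \<noteq> l i)"
        hence "k = l" using k l unfolding J_def by (intro PiE_ext) auto
        thus False using \<open>k \<noteq> l\<close> by contradiction
      qed
      then obtain i where i: "i < d" "k i \<noteq> l i" by blast
      have "(\<Sum>j<2 * N. \<phi> i (k i) j * \<phi> i (l i) j) = 0"
      proof (cases "i = d - 1")
        case True
        have "k i \<in> {1..N}" "l i \<in> {1..N}" using Jk[OF k i(1)] Jk[OF l i(1)] True by auto
        moreover have "b (k i) \<noteq> b (l i)" using i(2) by (auto simp: b_def field_simps)
        ultimately have "cos (b (k i)) \<noteq> cos (b (l i))" using cos_inj_pi b_range less_imp_le by metis
        thus ?thesis using pathfun_orthogonal[OF b b] True by (simp add: \<phi>_def)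
      next
        case False
        \<comment> \<open>Two indices in \<open>{1..2*N}\<close> differ by less than 2N, so half the
          frequency difference is a nonzero number in (-\<pi>, \<pi>), where the sine has no other
          zero.\<close>
        let ?z = "(a (k i) - a (l i)) / 2"
        have z: "?z = (real (k i) - real (l i)) * pi / (2 * real N)"
          using N by (simp add: a_def field_simps)
        have "k i \<in> {1..2*N}" "l i \<in> {1..2*N}" using Jk[OF k i(1)] Jk[OF l i(1)] False by auto
        hence "\<bar>real (k i) - real (l i)\<bar> < 2 * real N" by auto
        hence "\<bar>real (k i) - real (l i)\<bar> * pi < 2 * real N * pi" by (intro mult_strict_right_mono) auto
        moreover have "\<bar>?z\<bar> = \<bar>real (k i) - real (l i)\<bar> * pi / (2 * real N)"
          unfolding z by (simp add: abs_mult)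
        ultimately have "\<bar>?z\<bar> < pi" using N by (simp add: pos_divide_less_eq mult.commute)
        moreover have "?z \<noteq> 0" unfolding z using i(2) N by simp
        ultimately have "sin ?z \<noteq> 0" using sin_eq_0_pi[of ?z] by (auto simp: abs_less_iff)
        thus ?thesis using cas_orthogonal[OF a a] False by (simp add: \<phi>_def)
      qed
      thus ?thesis unfolding gram using i(1) by (intro prod_zero) auto
    qed
    show "(\<Sum>x\<in>?X. v k x * v k x) \<noteq> 0" if k: "k \<in> J" for k
    proof -
      have "(\<Sum>j<2 * N. \<phi> i (k i) j * \<phi> i (k i) j) \<noteq> 0" if i: "i < d" for i
      proof -
        \<comment> \<open>A point where the factor is visibly nonzero: the first path vertex, with
          value sin b, and the origin of a cycle, where \<open>cas\<close> equals 1.\<close>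
        define j where "j = (if i = d - 1 then N else 0)"
        have "\<phi> i (k i) j \<noteq> 0"
        proof (cases "i = d - 1")
          case True
          hence "k i \<in> {1..N}" using Jk[OF k i] by auto
          hence "0 < sin (b (k i))" using b_range by (intro sin_gt_zero)
          thus ?thesis using True by (simp add: \<phi>_def j_def pathfun_def)
        qed (simp add: \<phi>_def j_def cas_def)
        moreover have "j \<in> {..<2 * N}" using N by (auto simp: j_def)
        ultimately show ?thesis by (subst sum_nonneg_eq_0_iff) auto
      qed
      thus ?thesis unfolding gram by simp
    qed
    show "\<bar>\<mu> k\<bar> \<le> 1" for k
      using abs_sum_cos_le[OF d, of "\<lambda>i. a (k i)" "b (k (d - 1))"] d by (simp add: \<mu>_def)
  qed
  thus ?thesis unfolding J_def \<mu>_def a_def b_def power_divide by simp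
qed

text \<open>The path frequencies spread over (0, \<pi>). Doubling them gives nodes for the full
  circle, hence the half angle under the integral. The factor 1/2 is the proportion of unmarked
  vertices: half as many terms as the normalisation counts.\<close>

lemma zeta_inv_torus_Mcase2_tendsto:
  assumes d: "1 \<le> d" and u: "0 < u" "u < 1"
  shows "(\<lambda>N. zeta_inv_torus d N (Mcase2 d N) u)
    \<longlonglongrightarrow> exp ((2 * real d - 1/2) * ln (1 - u)
        + 1/2 * (LINT \<theta>|PiM {..<d} (\<lambda>_. uniform_measure lborel {0..<2*pi}).
             ln ((1 + u)^2 - 4 * u / (real d)^2 *
               ((\<Sum>i<d-1. cos (\<theta> i)) + cos (\<theta> (d-1) / 2))^2)))"
proof -
  let ?P = "PiM {..<d} (\<lambda>_. uniform_measure lborel {0..<2*pi}) :: (nat \<Rightarrow> real) measure"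
  define A where "A \<theta> = (1 + u)^2 - 4 * u / (real d)^2 * ((\<Sum>i<d-1. cos (\<theta> i)) + cos (\<theta> (d-1) / 2))^2"
    for \<theta> :: "nat \<Rightarrow> real"
  define F where "F \<theta> = ln (A \<theta>)" for \<theta>
  define n where "n i N = (if i = d - 1 then N else 2 * N)" for i N :: nat
  define t where "t i N k = (if i = d - 1 then 2 * real k * pi / real (N + 1) else (real k - 1) * pi / real N)"
    for i N k :: nat
  \<comment> \<open>The uniform positive lower bound keeps the logarithm continuous and bounded, as
    dominated convergence demands.\<close>
  have A: "(1 - u)\<^sup>2 \<le> A \<theta>" "A \<theta> \<le> (1 + u)\<^sup>2" for \<theta>
  proof -
    let ?c = "(\<Sum>i<d-1. cos (\<theta> i)) + cos (\<theta> (d-1) / 2)"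
    have "?c\<^sup>2 \<le> (real d)\<^sup>2"
      using abs_sum_cos_le[OF d, of \<theta> "\<theta> (d - 1) / 2"] abs_le_square_iff[of ?c "real d"]
      by (simp only: abs_of_nat)
    hence "4 * u / (real d)\<^sup>2 * ?c\<^sup>2 \<le> 4 * u / (real d)\<^sup>2 * (real d)\<^sup>2"
      using u by (intro mult_left_mono) auto
    hence "4 * u / (real d)\<^sup>2 * ?c\<^sup>2 \<le> 4 * u" using d by simp
    moreover have "(1 - u)\<^sup>2 = (1 + u)\<^sup>2 - 4 * u" by (simp add: power2_eq_square algebra_simps)
    moreover have "0 \<le> 4 * u / (real d)\<^sup>2 * ?c\<^sup>2" using u by simp
    ultimately show "(1 - u)\<^sup>2 \<le> A \<theta>" "A \<theta> \<le> (1 + u)\<^sup>2" unfolding A_def by linarith+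
  qed
  have u1: "0 < (1 - u)\<^sup>2" using u by simp
  have A_pos: "0 < A \<theta>" for \<theta> using A(1)[of \<theta>] u1 by linarith
  have lim: "(\<lambda>N. (\<Sum>k\<in>PiE {..<d} (\<lambda>i. {1..n i N}). F (\<lambda>i. t i N (k i))) / (\<Prod>i\<in>{..<d}. real (n i N)))
    \<longlonglongrightarrow> (LINT \<theta>|?P. F \<theta>)"
  proof (rule Riemann_sums_uniform_circle_tendsto)
    show "filterlim (n i) at_top sequentially" for i
    proof -
      have "filterlim (\<lambda>N::nat. 2 * N) at_top sequentially"
        by (rule mult_nat_left_at_top) simp
      thus ?thesis by (cases "i = d - 1") (simp_all add: n_def[abs_def] filterlim_ident)
    qed
    \<comment> \<open>For the last coordinate this is (k - 1)/N \<le> k/(N + 1) \<le> k/N, valid as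
      k \<le> N; for the others the node is the left end of its cell.\<close>
    show "t i N k \<in> {2 * pi * (real k - 1) / real (n i N) .. 2 * pi * real k / real (n i N)}"
      if "k \<in> {1..n i N}" for i N k
    proof (cases "i = d - 1")
      case True
      hence k: "1 \<le> real k" "real k \<le> real N" using that by (auto simp: n_def)
      have "(real k - 1) / real N \<le> real k / (real N + 1)" "real k / (real N + 1) \<le> real k / real N"
        using k by (auto simp: field_simps)
      hence "2 * pi * ((real k - 1) / real N) \<le> 2 * pi * (real k / (real N + 1))"
        "2 * pi * (real k / (real N + 1)) \<le> 2 * pi * (real k / real N)"
        by (intro mult_left_mono; simp)+
      thus ?thesis using True by (simp add: t_def n_def mult_ac add.commute)
    next
      case False
      hence "0 < N" using that by (auto simp: n_def)
      thus ?thesis using False by (auto simp: t_def n_def field_simps)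
    qed
    show "(\<lambda>N. F (X N)) \<longlonglongrightarrow> F \<theta>" if X: "\<And>i. i \<in> {..<d} \<Longrightarrow> (\<lambda>N. X N i) \<longlonglongrightarrow> \<theta> i" for X \<theta>
    proof -
      have X': "(\<lambda>N. X N i) \<longlonglongrightarrow> \<theta> i" if "i < d - 1 \<or> i = d - 1" for i using X that d by auto
      have "(\<lambda>N. A (X N)) \<longlonglongrightarrow> A \<theta>"
        unfolding A_def by (intro tendsto_intros X') auto
      thus ?thesis unfolding F_def using A_pos[of \<theta>] by (intro tendsto_ln) auto
    qed
    \<comment> \<open>The two logarithms have opposite signs, so their difference dominates both
      absolute values.\<close>
    show "\<bar>F \<theta>\<bar> \<le> ln ((1 + u)\<^sup>2) - ln ((1 - u)\<^sup>2)" for \<theta>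
    proof -
      have "ln ((1 - u)\<^sup>2) \<le> F \<theta>"
        unfolding F_def by (rule iffD2[OF ln_le_cancel_iff[OF u1 A_pos] A(1)])
      moreover have "F \<theta> \<le> ln ((1 + u)\<^sup>2)"
        unfolding F_def by (rule iffD2[OF ln_le_cancel_iff[OF A_pos less_le_trans[OF A_pos A(2)]] A(2)])
      moreover have "ln ((1 - u)\<^sup>2) \<le> 0" "0 \<le> ln ((1 + u)\<^sup>2)"
        using u by (auto simp: power_le_one one_le_power)
      ultimately show ?thesis by linarith
    qed
    have comp: "(\<lambda>\<theta>. \<theta> i) \<in> borel_measurable ?P" if "i < d" for i
    proof -
      have "(\<lambda>\<theta>. \<theta> i) \<in> measurable ?P (uniform_measure lborel {0..<2*pi})"
        using that by (intro measurable_component_singleton) auto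
      moreover have "sets (uniform_measure lborel {0..<2*pi}) = sets (borel :: real measure)" by simp
      ultimately show ?thesis using measurable_cong_sets[OF refl] by blast
    qed
    show "F \<in> borel_measurable ?P"
      unfolding F_def[abs_def] A_def using d
      by (intro borel_measurable_ln borel_measurable_diff borel_measurable_times borel_measurable_power
          borel_measurable_add borel_measurable_sum measurable_compose[OF _ borel_measurable_cos] borel_measurable_divide
          borel_measurable_const comp) auto
  qed simp
  have prod_n: "(\<Prod>i\<in>{..<d}. real (n i N)) = real ((2 * N) ^ d) / 2" for N
  proof -
    have "(\<Prod>i\<in>{..<d}. real (n i N)) = (\<Prod>i<d. if i = d - 1 then real N else 2 * real N)"
      by (intro prod.cong) (auto simp: n_def)
    also have "\<dots> = real N * (2 * real N) ^ (d - 1)" by (rule prod_lessThan_last[OF d])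
    also have "\<dots> = real ((2 * N) ^ d) / 2" using d by (cases d) simp_all
    finally show ?thesis .
  qed
  have sets: "PiE {..<d} (\<lambda>i. {1..n i N}) = PiE {..<d} (\<lambda>i. if i = d - 1 then {1..N} else {1..2*N})" for N
    by (intro PiE_cong) (auto simp: n_def)
  have Ft: "F (\<lambda>i. t i N (k i)) = ln ((1 + u)^2 - 4 * u / (real d)^2 *
      ((\<Sum>i<d-1. cos ((real (k i) - 1) * pi / real N)) + cos (real (k (d-1)) * pi / real (N + 1)))^2)" for N k
  proof -
    have "(\<Sum>i<d-1. cos (t i N (k i))) = (\<Sum>i<d-1. cos ((real (k i) - 1) * pi / real N))"
      by (intro sum.cong) (auto simp: t_def)
    moreover have "t (d - 1) N (k (d - 1)) / 2 = real (k (d-1)) * pi / real (N + 1)"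
      by (simp add: t_def field_simps)
    ultimately show ?thesis unfolding F_def A_def by (simp only:)
  qed
  define S where "S N = (\<Sum>k\<in>PiE {..<d} (\<lambda>i. if i = d - 1 then {1..N} else {1..2*N}).
             ln ((1 + u)^2 - 4 * u / (real d)^2 *
               ((\<Sum>i<d-1. cos ((real (k i) - 1) * pi / real N))
                + cos (real (k (d-1)) * pi / real (N + 1)))^2))" for N :: nat
  have "(\<lambda>N. S N / (real ((2 * N) ^ d) / 2)) \<longlonglongrightarrow> (LINT \<theta>|?P. F \<theta>)"
    using lim unfolding prod_n sets Ft S_def .
  hence "(\<lambda>N. exp ((2 * real d - 1/2) * ln (1 - u) + 1/2 * (S N / (real ((2 * N) ^ d) / 2))))
      \<longlonglongrightarrow> exp ((2 * real d - 1/2) * ln (1 - u) + 1/2 * (LINT \<theta>|?P. F \<theta>))"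
    by (intro tendsto_intros)
  moreover have "\<forall>\<^sub>F N in sequentially. exp ((2 * real d - 1/2) * ln (1 - u) + 1/2 * (S N / (real ((2 * N) ^ d) / 2)))
      = zeta_inv_torus d N (Mcase2 d N) u"
    using eventually_ge_at_top[of 2]
  proof eventually_elim
    case (elim N)
    show ?case unfolding zeta_inv_torus_Mcase2[OF d elim u] S_def[symmetric] by simp
  qed
  ultimately show ?thesis unfolding F_def A_def by (rule Lim_transform_eventually)
qed

theorem theorem2:
  fixes d :: nat and u :: real
  assumes "d \<ge> 1" and "0 < u" and "u < 1"
  shows "(\<forall>N\<ge>2. zeta_inv_torus d N (Mcase1 d N) u
            = exp ((2 * real d - 1/2) * ln (1 - u) + ln (1 + u)))
    \<and> ((\<lambda>N. zeta_inv_torus d N (Mcase1 d N) u)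
            \<longlonglongrightarrow> exp ((2 * real d - 1/2) * ln (1 - u) + ln (1 + u)))
    \<and> (\<forall>N\<ge>2. zeta_inv_torus d N (Mcase2 d N) u
            = exp ((2 * real d - 1/2) * ln (1 - u)
                + 1 / real ((2*N)^d) *
                  (\<Sum>k\<in>PiE {..<d} (\<lambda>i. if i = d - 1 then {1..N} else {1..2*N}).
                     ln ((1 + u)^2 - 4 * u / (real d)^2 *
                       ((\<Sum>i<d-1. cos ((real (k i) - 1) * pi / real N))
                        + cos (real (k (d-1)) * pi / real (N + 1)))^2))))
    \<and> ((\<lambda>N. zeta_inv_torus d N (Mcase2 d N) u)
            \<longlonglongrightarrow> exp ((2 * real d - 1/2) * ln (1 - u)
                + 1/2 * (LINT \<theta>|PiM {..<d} (\<lambda>_. uniform_measure lborel {0..<2*pi}).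
                     ln ((1 + u)^2 - 4 * u / (real d)^2 *
                       ((\<Sum>i<d-1. cos (\<theta> i)) + cos (\<theta> (d-1) / 2))^2))))"
proof (intro conjI)
  show case1: "\<forall>N\<ge>2. zeta_inv_torus d N (Mcase1 d N) u
      = exp ((2 * real d - 1/2) * ln (1 - u) + ln (1 + u))"
    using zeta_inv_torus_Mcase1 assms by blast
  show "(\<lambda>N. zeta_inv_torus d N (Mcase1 d N) u)
      \<longlonglongrightarrow> exp ((2 * real d - 1/2) * ln (1 - u) + ln (1 + u))"
    using case1 by (intro tendsto_eventually eventually_sequentiallyI[of 2]) auto
qed (use zeta_inv_torus_Mcase2 zeta_inv_torus_Mcase2_tendsto assms in blast)+

end
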